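(* Let $G$ be a group containing a finite-index subgroup isomorphic to $\mathbb{Z}^n\times F_m$ for some $n,m\geq 0$. Then for every finite (monoid) generating set $X$ of $G$ and every regular language $R\subseteq X^*$, the cogrowth series $C_R(z)$ can be written as the diagonal of a rational function; that is, there are an integer $p\geq 1$ and a rational power series $r(x_1,\ldots,x_p)\in\mathbb{Q}[[x_1,\ldots,x_p]]$ such that $C_R(z)=\mathrm{Diag}(r)(z)$.
   Context: $\mathbb{N}=\{0,1,2,\ldots\}$ and $F_m$ denotes the free group of rank $m$. A finite monoid generating set $X$ of $G$ is a finite set of elements generating $G$ as a monoid; $X^*$ is the set of all words over $X$; for $w\in X^*$, $|w|_X$ is its length as a word and $\overline{w}\in G$ is the element it represents. A language $R\subseteq X^*$ is regular if it is accepted by a finite-state automaton. The cogrowth series of $G$ with respect to $R$ is $C_R(z)=\sum_{k=0}^\infty c_k z^k\in\mathbb{N}[[z]]$, where $c_k=\#\{w\in R\mid |w|_X=k \text{ and } \overline{w}=1\}$. A power series $f(\mathbf{x})\in\mathbb{Q}[[\mathbf{x}]]$ in variables $\mathbf{x}=(x_1,\ldots,x_p)$ is rational if there are polynomials $P,Q\in\mathbb{Z}[\mathbf{x}]$ with $f=P/Q$. The (complete) diagonal of $f(\mathbf{x})=\sum_{k_1,\ldots,k_p\in\mathbb{N}}a(k_1,\ldots,k_p)x_1^{k_1}\cdots x_p^{k_p}$ is the univariate power series $\mathrm{Diag}(f)(z)=\sum_{k\in\mathbb{N}}a(k,k,\ldots,k)z^k$. *)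

theory Defs
  imports
    "HOL-Algebra.Product_Groups"
    "HOL-Computational_Algebra.Formal_Power_Series"
    "HOL-Library.Poly_Mapping"
begin

text \<open>
  The free group on a set \<open>S\<close>, realised as the set of freely reduced words.  A letter is a pair
  \<open>(s, b)\<close> standing for \<open>s\<close> if \<open>b\<close> holds and for the formal inverse of \<open>s\<close> otherwise.
\<close>

fun inv_letter :: "'s \<times> bool \<Rightarrow> 's \<times> bool" where
  "inv_letter (s, b) = (s, \<not> b)"

definition freely_reduced :: "('s \<times> bool) list \<Rightarrow> bool" where
  "freely_reduced w \<longleftrightarrow> successively (\<lambda>x y. y \<noteq> inv_letter x) w"

fun reduced_Cons :: "'s \<times> bool \<Rightarrow> ('s \<times> bool) list \<Rightarrow> ('s \<times> bool) list" where
  "reduced_Cons x [] = [x]"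
| "reduced_Cons x (y # ys) = (if y = inv_letter x then ys else x # y # ys)"

definition free_group :: "'s set \<Rightarrow> ('s \<times> bool) list monoid" where
  "free_group S =
     \<lparr>carrier = {w. freely_reduced w \<and> fst ` set w \<subseteq> S},
      monoid.mult = (\<lambda>u v. foldr reduced_Cons u v),
      one = []\<rparr>"

lemma inv_letter_inv_letter [simp]: "inv_letter (inv_letter x) = x"
  by (cases x) auto

lemma fst_inv_letter [simp]: "fst (inv_letter x) = fst x"
  by (cases x) auto

lemma freely_reduced_Nil [simp]: "freely_reduced []"
  by (simp add: freely_reduced_def)

lemma freely_reduced_Cons:
  "freely_reduced (x # w) \<longleftrightarrow> freely_reduced w \<and> (w \<noteq> [] \<longrightarrow> hd w \<noteq> inv_letter x)"
  by (auto simp: freely_reduced_def successively_Cons)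

lemma freely_reduced_reduced_Cons:
  "freely_reduced w \<Longrightarrow> freely_reduced (reduced_Cons x w)"
  by (cases w) (auto simp: freely_reduced_Cons)

lemma set_reduced_Cons: "set (reduced_Cons x w) \<subseteq> insert x (set w)"
  by (cases w) auto

lemma reduced_Cons_cancel:
  "freely_reduced w \<Longrightarrow> reduced_Cons x (reduced_Cons (inv_letter x) w) = w"
  by (cases w rule: remdups_adj.cases) (auto simp: freely_reduced_Cons)

lemma freely_reduced_foldr:
  "freely_reduced v \<Longrightarrow> freely_reduced (foldr reduced_Cons u v)"
  by (induction u) (auto simp: freely_reduced_reduced_Cons)

lemma set_foldr_reduced_Cons: "set (foldr reduced_Cons u v) \<subseteq> set u \<union> set v"
  by (induction u) (use set_reduced_Cons in fastforce)+

lemma foldr_reduced_Cons_Cons: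
  assumes "freely_reduced w"
  shows "foldr reduced_Cons (reduced_Cons x v) w = reduced_Cons x (foldr reduced_Cons v w)"
  using assms by (cases v) (auto simp: reduced_Cons_cancel freely_reduced_foldr)

lemma foldr_reduced_Cons_assoc:
  assumes "freely_reduced w"
  shows "foldr reduced_Cons (foldr reduced_Cons u v) w =
         foldr reduced_Cons u (foldr reduced_Cons v w)"
  using assms by (induction u) (auto simp: foldr_reduced_Cons_Cons)

lemma foldr_reduced_Cons_Nil: "freely_reduced u \<Longrightarrow> foldr reduced_Cons u [] = u"
proof (induction u)
  case (Cons x u)
  then show ?case by (cases u) (auto simp: freely_reduced_Cons)
qed simp

lemma freely_reduced_inverse:
  fixes w :: "('s \<times> bool) list"
  assumes "freely_reduced w"
  shows "freely_reduced (rev (map inv_letter w))"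
proof -
 have "inv_letter y = x \<longleftrightarrow> y = inv_letter x" for x y :: "'s \<times> bool"
    by (cases x; cases y) auto
  with assms show ?thesis
    unfolding freely_reduced_def successively_rev successively_map
    by (elim successively_mono) (metis inv_letter_inv_letter)
qed

lemma foldr_reduced_Cons_inverse:
  "freely_reduced v \<Longrightarrow>
   foldr reduced_Cons (rev (map inv_letter w)) (foldr reduced_Cons w v) = v"
proof (induction w)
  case (Cons x w)
  then show ?case
    using reduced_Cons_cancel[of "foldr reduced_Cons w v" "inv_letter x"]
    by (simp add: freely_reduced_foldr)
qed simp

theorem group_free_group: "group (free_group S)"
proof (rule groupI)
  fix u v
  assume uv: "u \<in> carrier (free_group S)" "v \<in> carrier (free_group S)"
  then show "u \<otimes>\<^bsub>free_group S\<^esub> v \<in> carrier (free_group S)"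
    using set_foldr_reduced_Cons[of u v]
    by (fastforce simp: free_group_def freely_reduced_foldr)
next
  fix w assume w: "w \<in> carrier (free_group S)"
  show "\<exists>v\<in>carrier (free_group S). v \<otimes>\<^bsub>free_group S\<^esub> w = \<one>\<^bsub>free_group S\<^esub>"
  proof (rule bexI[of _ "rev (map inv_letter w)"])
    show "rev (map inv_letter w) \<otimes>\<^bsub>free_group S\<^esub> w = \<one>\<^bsub>free_group S\<^esub>"
      using w foldr_reduced_Cons_inverse[of "[]" w]
      by (simp add: free_group_def foldr_reduced_Cons_Nil)
    show "rev (map inv_letter w) \<in> carrier (free_group S)"
      using w by (auto simp: free_group_def freely_reduced_inverse)
  qed
qed (auto simp: free_group_def foldr_reduced_Cons_assoc)

definition word_value :: "('a, 'b) monoid_scheme \<Rightarrow> 'a list \<Rightarrow> 'a" where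
  "word_value G w = foldr (\<lambda>x y. x \<otimes>\<^bsub>G\<^esub> y) w \<one>\<^bsub>G\<^esub>"

definition finite_monoid_generating_set :: "('a, 'b) monoid_scheme \<Rightarrow> 'a set \<Rightarrow> bool" where
  "finite_monoid_generating_set G X \<longleftrightarrow>
     finite X \<and> X \<subseteq> carrier G \<and> word_value G ` lists X = carrier G"

record ('q, 'a) automaton =
  states :: "'q set"
  initial :: 'q
  final :: "'q set"
  transition :: "'q \<Rightarrow> 'a \<Rightarrow> 'q"

definition finite_automaton :: "'a set \<Rightarrow> ('q, 'a) automaton \<Rightarrow> bool" where
  "finite_automaton X A \<longleftrightarrow>
     finite (states A) \<and> initial A \<in> states A \<and> final A \<subseteq> states A \<and>
     (\<forall>q\<in>states A. \<forall>x\<in>X. transition A q x \<in> states A)"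

definition accepted_language :: "'a set \<Rightarrow> ('q, 'a) automaton \<Rightarrow> 'a list set" where
  "accepted_language X A = {w \<in> lists X. foldl (transition A) (initial A) w \<in> final A}"

text \<open>
  Taking natural numbers as states is no restriction, since the states of a finite automaton can be
  renamed.
\<close>

definition regular_language :: "'a set \<Rightarrow> 'a list set \<Rightarrow> bool" where
  "regular_language X R \<longleftrightarrow>
     (\<exists>A :: (nat, 'a) automaton. finite_automaton X A \<and> R = accepted_language X A)"

definition cogrowth_series :: "('a, 'b) monoid_scheme \<Rightarrow> 'a list set \<Rightarrow> rat fps" where
  "cogrowth_series G R =
     Abs_fps (\<lambda>k. of_nat (card {w \<in> R. length w = k \<and> word_value G w = \<one>\<^bsub>G\<^esub>}))"

text \<open>
  The variables are indexed by natural numbers, a monomial is given by its exponent vector of type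
  \<^typ>\<open>nat \<Rightarrow>\<^sub>0 nat\<close>, and a formal power series is the function sending an exponent vector to the
  corresponding coefficient.  The monomials in \<open>p\<close> variables are those that only involve
  the variables with index below \<open>p\<close>.
\<close>

type_synonym 'a mpoly = "(nat \<Rightarrow>\<^sub>0 nat) \<Rightarrow>\<^sub>0 'a"
type_synonym 'a mfps = "(nat \<Rightarrow>\<^sub>0 nat) \<Rightarrow> 'a"

definition monomials :: "nat \<Rightarrow> (nat \<Rightarrow>\<^sub>0 nat) set" where
  "monomials p = {e. Poly_Mapping.keys e \<subseteq> {..<p}}"

definition mpolys :: "nat \<Rightarrow> 'a::zero mpoly set" where
  "mpolys p = {P. Poly_Mapping.keys P \<subseteq> monomials p}"

definition mfpss :: "nat \<Rightarrow> 'a::zero mfps set" where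
  "mfpss p = {f. \<forall>e. e \<notin> monomials p \<longrightarrow> f e = 0}"

definition mfps_of_mpoly :: "int mpoly \<Rightarrow> rat mfps" where
  "mfps_of_mpoly P = (\<lambda>e. of_int (Poly_Mapping.lookup P e))"

definition mfps_times :: "'a::comm_semiring_1 mfps \<Rightarrow> 'a mfps \<Rightarrow> 'a mfps" where
  "mfps_times f g = (\<lambda>e. \<Sum>(d, d') | d + d' = e. f d * g d')"

lemma finite_exponent_decompositions: "finite {(d, d'). d + d' = (e :: nat \<Rightarrow>\<^sub>0 nat)}"
proof -
  let ?B = "{..Max (Poly_Mapping.lookup e ` Poly_Mapping.keys e)}"
  let ?F = "{h :: nat \<Rightarrow> nat. \<forall>i. (i \<in> Poly_Mapping.keys e \<longrightarrow> h i \<in> ?B) \<and>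
              (i \<notin> Poly_Mapping.keys e \<longrightarrow> h i = 0)}"
  have "finite ?F"
    by (intro finite_set_of_finite_funs) auto
  moreover have "Poly_Mapping.lookup ` {d. \<exists>d'. d + d' = e} \<subseteq> ?F"
  proof (intro image_subsetI CollectI allI)
    fix d i
    assume "d \<in> {d. \<exists>d'. d + d' = e}"
    then have le: "Poly_Mapping.lookup d i \<le> Poly_Mapping.lookup e i"
      by (auto simp: lookup_add)
    then have "Poly_Mapping.lookup d i \<in> ?B" if "i \<in> Poly_Mapping.keys e"
      using Max_ge[of "Poly_Mapping.lookup e ` Poly_Mapping.keys e" "Poly_Mapping.lookup e i"] that
      by (simp del: Max_ge)
    moreover have "Poly_Mapping.lookup d i = 0" if "i \<notin> Poly_Mapping.keys e"
      using le that by (simp add: in_keys_iff)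
    ultimately show "(i \<in> Poly_Mapping.keys e \<longrightarrow> Poly_Mapping.lookup d i \<in> ?B) \<and>
        (i \<notin> Poly_Mapping.keys e \<longrightarrow> Poly_Mapping.lookup d i = 0)"
      by blast
  qed
  ultimately have "finite (Poly_Mapping.lookup ` {d. \<exists>d'. d + d' = e})"
    using finite_subset by blast
  then have "finite {d. \<exists>d'. d + d' = e}"
    by (rule finite_imageD) (auto intro: inj_onI poly_mapping_eqI)
  then have "finite ((\<lambda>d. (d, e - d)) ` {d. \<exists>d'. d + d' = e})"
    by blast
  then show ?thesis
    by (rule rev_finite_subset) auto
qed

text \<open>
  The equation \<open>f = P / Q\<close> is understood in the field of fractions of the power series ring, that is,
  as \<open>Q f = P\<close> with \<open>Q \<noteq> 0\<close>.
\<close>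

definition rational_mfps :: "nat \<Rightarrow> rat mfps \<Rightarrow> bool" where
  "rational_mfps p f \<longleftrightarrow>
     f \<in> mfpss p \<and>
     (\<exists>P\<in>mpolys p. \<exists>Q\<in>mpolys p. Q \<noteq> 0 \<and>
        mfps_times (mfps_of_mpoly Q) f = mfps_of_mpoly P)"

definition diagonal :: "nat \<Rightarrow> 'a mfps \<Rightarrow> 'a fps" where
  "diagonal p f = Abs_fps (\<lambda>k. f (\<Sum>i<p. Poly_Mapping.single i k))"

end

theory Submission
  imports Defs "Jordan_Normal_Form.Determinant"
begin

text \<open>
  Choosing representatives of the cosets of \<open>H\<close> turns a word over \<open>X\<close> into a path in a finite graph
  whose edges carry labels in \<open>\<int>\<^sup>n \<times> F\<^sub>m\<close>, and \<open>C\<^sub>R\<close> counts the paths with trivial label.  The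
  \<open>\<int>\<^sup>n\<close>-part is recorded by a Laurent monomial.  For the \<open>F\<^sub>m\<close>-part, let \<open>y(a, \<sigma>, \<rho>)\<close> count the paths
  from \<open>\<sigma>\<close> to \<open>\<rho>\<close> that reach the letter \<open>a\<close> for the first time in their last step.  Decomposing
  paths in the Cayley tree of \<open>F\<^sub>m\<close> by first passages gives a polynomial system
  \<open>y\<^sub>i = X \<phi>\<^sub>i(y)\<close>.  By the multivariate Lagrange inversion formula of Jacobi and Good, its solution
  \<open>Y\<close> satisfies
  \<open>Y\<^sub>k = CT (y\<^sub>k det(\<delta>\<^sub>i\<^sub>j - X \<partial>\<^sub>j \<phi>\<^sub>i(y)) \<Prod>\<^sub>i (1 - X \<phi>\<^sub>i(y) / y\<^sub>i)\<^sup>-\<^sup>1)\<close>, where \<open>CT\<close> is the constant term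
  in the variables \<open>y\<^sub>i\<close>.  Hence \<open>C\<^sub>R\<close> is the constant term of a rational function in which every
  variable occurs in the coefficient of \<open>X\<^sup>N\<close> with exponent at least \<open>-N\<close>, and replacing \<open>X\<close> by
  the product of \<open>X\<close> and all other variables turns the constant term into a diagonal.
\<close>

text \<open>The lower bound -N on exponents shapes the encoding. The label of a letter of
  \<open>X\<close> may have large negative exponents and many free letters, so it is cut into edges
  that lower each exponent by at most one and emit at most one free letter. Paths become longer than
  words; idle edges give all labels the same length, and only the coefficients at multiples of that
  length are wanted. This length is a power of two because sections by two need only sign changes:
  multiplied by its conjugates, a denominator becomes even in every variable without leaving the
  rationals, whereas a general period would bring in roots of unity. The inversion formula rests on
  one determinant. With e_i = X phi_i(y), the factor by which a series is multiplied is the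
  determinant of the logarithmic derivatives of the y_i - e_i. It does not change the constant term
  of a series free of the unknowns, and it makes the constant term of every multiple of y_i - e_i by
  a power series in y vanish. Since y_i - Y_i differs from y_i - e_i by X times a combination of the
  y_j - Y_j, the unknowns may be replaced by the solution.\<close>

no_notation vec_index (infixl \<open>$\<close> 100)
unbundle fps_syntax

text \<open>
  The variable of a power series of type \<open>laurent fps\<close> counts the steps of a path.  Among the
  variables of the coefficients, those with index below \<open>n\<close> belong to \<open>\<int>\<^sup>n\<close>, and the unknowns
  of the polynomial system are numbered from \<open>n\<close> on.
\<close>

type_synonym expo = "nat \<Rightarrow>\<^sub>0 int"
type_synonym laurent = "expo \<Rightarrow>\<^sub>0 rat"

abbreviation lookup where "lookup \<equiv> Poly_Mapping.lookup"
abbreviation keys where "keys \<equiv> Poly_Mapping.keys"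
abbreviation single where "single \<equiv> Poly_Mapping.single"

section \<open>Coefficients of products of Laurent-valued power series\<close>

lemma lookup_times_superset:
  fixes f g :: "'a::ab_group_add \<Rightarrow>\<^sub>0 'b::comm_ring_1"
  assumes "finite B" "keys f \<subseteq> B"
  shows "lookup (f * g) \<alpha> = (\<Sum>\<beta>\<in>B. lookup f \<beta> * lookup g (\<alpha> - \<beta>))"
proof -
  have inner: "(\<Sum>q. lookup g q when \<alpha> = \<beta> + q) = lookup g (\<alpha> - \<beta>)" for \<beta>
  proof -
    have "(\<alpha> = \<beta> + q) = (q = \<alpha> - \<beta>)" for q by (auto simp: algebra_simps)
    then show ?thesis by simp
  qed
  have "lookup (f * g) \<alpha> = (\<Sum>\<beta>. lookup f \<beta> * lookup g (\<alpha> - \<beta>))"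
    unfolding lookup_mult inner ..
  also have "\<dots> = (\<Sum>\<beta>\<in>B. lookup f \<beta> * lookup g (\<alpha> - \<beta>))"
  proof (rule Sum_any.expand_superset[OF assms(1)])
    show "{\<beta>. lookup f \<beta> * lookup g (\<alpha> - \<beta>) \<noteq> 0} \<subseteq> B"
    proof
      fix \<beta> assume "\<beta> \<in> {\<beta>. lookup f \<beta> * lookup g (\<alpha> - \<beta>) \<noteq> 0}"
      then have "lookup f \<beta> \<noteq> 0" by auto
      with assms(2) show "\<beta> \<in> B" by (auto simp: in_keys_iff)
    qed
  qed
  finally show ?thesis .
qed

lemma coeff_times_superset:
  fixes F G :: "laurent fps"
  assumes "\<And>i. i \<le> N \<Longrightarrow> finite (B i)" "\<And>i. i \<le> N \<Longrightarrow> keys (F $ i) \<subseteq> B i"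
  shows "lookup ((F * G) $ N) \<alpha>
    = (\<Sum>i\<le>N. \<Sum>\<beta>\<in>B i. lookup (F $ i) \<beta> * lookup (G $ (N - i)) (\<alpha> - \<beta>))"
  using assms
  by (auto simp: fps_mult_nth lookup_sum lookup_times_superset[where B = "B _"] atLeast0AtMost
      intro!: sum.cong)

lemma laurent_fps_eqI:
  fixes F G :: "laurent fps"
  shows "(\<And>N \<alpha>. lookup (F $ N) \<alpha> = lookup (G $ N) \<alpha>) \<Longrightarrow> F = G"
  by (auto intro!: fps_ext poly_mapping_eqI)

subsection \<open>Weights\<close>

text \<open>One operator for two purposes: additive weights give derivations (Euler derivatives in
  \<open>X\<close> or in a Laurent variable), multiplicative weights give ring endomorphisms (sign
  changes of variables).\<close>

definition weigh :: "(nat \<Rightarrow> expo \<Rightarrow> rat) \<Rightarrow> laurent fps \<Rightarrow> laurent fps" where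
  "weigh w F = Abs_fps (\<lambda>N. Poly_Mapping.mapp (\<lambda>\<alpha> c. w N \<alpha> * c) (F $ N))"

lemma lookup_weigh [simp]: "lookup (weigh w F $ N) \<alpha> = w N \<alpha> * lookup (F $ N) \<alpha>"
  by (auto simp: weigh_def lookup_mapp when_def in_keys_iff)

lemma keys_weigh: "keys (weigh w F $ N) \<subseteq> keys (F $ N)"
  by (auto simp: in_keys_iff)

lemma weigh_0 [simp]: "weigh w 0 = 0"
  by (rule laurent_fps_eqI) simp

lemma weigh_add: "weigh w (F + G) = weigh w F + weigh w G"
  by (rule laurent_fps_eqI) (simp add: lookup_add algebra_simps)

lemma weigh_minus: "weigh w (F - G) = weigh w F - weigh w G"
  by (rule laurent_fps_eqI) (simp add: lookup_minus algebra_simps)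

lemma weigh_commute: "weigh w (weigh w' F) = weigh w' (weigh w F)"
  by (rule laurent_fps_eqI) simp

lemma weigh_times_deriv:
  assumes "\<And>M N \<alpha> \<beta>. w (M + N) (\<alpha> + \<beta>) = w M \<alpha> + w N \<beta>"
  shows "weigh w (F * G) = weigh w F * G + F * weigh w G"
proof (rule laurent_fps_eqI)
  fix N \<alpha>
  let ?B = "\<lambda>i. keys (F $ i)"
  have w: "w N \<alpha> = w i \<beta> + w (N - i) (\<alpha> - \<beta>)" if "i \<le> N" for i \<beta>
    using assms[of i "N - i" \<beta> "\<alpha> - \<beta>"] that by simp
  have 1: "lookup (weigh w (F * G) $ N) \<alpha> = (\<Sum>i\<le>N. \<Sum>\<beta>\<in>?B i.
      w N \<alpha> * (lookup (F $ i) \<beta> * lookup (G $ (N - i)) (\<alpha> - \<beta>)))"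
    by (simp add: coeff_times_superset[where B = ?B] sum_distrib_left)
  have "lookup ((weigh w F * G + F * weigh w G) $ N) \<alpha> = (\<Sum>i\<le>N. \<Sum>\<beta>\<in>?B i.
      (w i \<beta> * lookup (F $ i) \<beta>) * lookup (G $ (N - i)) (\<alpha> - \<beta>)
      + lookup (F $ i) \<beta> * (w (N - i) (\<alpha> - \<beta>) * lookup (G $ (N - i)) (\<alpha> - \<beta>)))"
    by (simp only: fps_add_nth lookup_add sum.distrib coeff_times_superset[where B = ?B]
        finite_keys keys_weigh lookup_weigh order_refl)
  also have "\<dots> = (\<Sum>i\<le>N. \<Sum>\<beta>\<in>?B i.
      (w i \<beta> + w (N - i) (\<alpha> - \<beta>)) * (lookup (F $ i) \<beta> * lookup (G $ (N - i)) (\<alpha> - \<beta>)))"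
    by (intro sum.cong refl) (simp only: algebra_simps)
  finally have 2: "lookup ((weigh w F * G + F * weigh w G) $ N) \<alpha> = (\<Sum>i\<le>N. \<Sum>\<beta>\<in>?B i.
      (w i \<beta> + w (N - i) (\<alpha> - \<beta>)) * (lookup (F $ i) \<beta> * lookup (G $ (N - i)) (\<alpha> - \<beta>)))" .
  show "lookup (weigh w (F * G) $ N) \<alpha> = lookup ((weigh w F * G + F * weigh w G) $ N) \<alpha>"
    unfolding 1 2 by (intro sum.cong refl) (simp add: w[symmetric])
qed

lemma weigh_times_hom:
  assumes "\<And>M N \<alpha> \<beta>. w (M + N) (\<alpha> + \<beta>) = w M \<alpha> * w N \<beta>"
  shows "weigh w (F * G) = weigh w F * weigh w G"
proof (rule laurent_fps_eqI)
  fix N \<alpha>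
  let ?B = "\<lambda>i. keys (F $ i)"
  have w: "w N \<alpha> = w i \<beta> * w (N - i) (\<alpha> - \<beta>)" if "i \<le> N" for i \<beta>
    using assms[of i "N - i" \<beta> "\<alpha> - \<beta>"] that by simp
  have 1: "lookup (weigh w (F * G) $ N) \<alpha> = (\<Sum>i\<le>N. \<Sum>\<beta>\<in>?B i.
      w N \<alpha> * (lookup (F $ i) \<beta> * lookup (G $ (N - i)) (\<alpha> - \<beta>)))"
    by (simp add: coeff_times_superset[where B = ?B] sum_distrib_left)
  have 2: "lookup ((weigh w F * weigh w G) $ N) \<alpha> = (\<Sum>i\<le>N. \<Sum>\<beta>\<in>?B i.
      (w i \<beta> * w (N - i) (\<alpha> - \<beta>)) * (lookup (F $ i) \<beta> * lookup (G $ (N - i)) (\<alpha> - \<beta>)))"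
    by (simp add: coeff_times_superset[where B = ?B] keys_weigh mult_ac)
  show "lookup (weigh w (F * G) $ N) \<alpha> = lookup ((weigh w F * weigh w G) $ N) \<alpha>"
    unfolding 1 2 by (intro sum.cong refl) (simp add: w[symmetric])
qed

subsection \<open>Graded supports\<close>

text \<open>The pairs (N, \<alpha>) with \<alpha> in \<open>C N\<close> form a submonoid, so that
  \<open>supported C\<close> is a subring. Constant families, \<open>box\<close> and
  \<open>nonneg\<close> are the instances.\<close>

definition graded :: "(nat \<Rightarrow> expo set) \<Rightarrow> bool" where
  "graded C \<longleftrightarrow> 0 \<in> C 0 \<and> (\<forall>M N. \<forall>\<alpha>\<in>C M. \<forall>\<beta>\<in>C N. \<alpha> + \<beta> \<in> C (M + N))"

definition supported :: "(nat \<Rightarrow> expo set) \<Rightarrow> laurent fps set" where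
  "supported C = {F. \<forall>N. keys (F $ N) \<subseteq> C N}"

lemma supported_mono: "(\<And>N. C N \<subseteq> D N) \<Longrightarrow> supported C \<subseteq> supported D"
  by (fastforce simp: supported_def)

lemma supported_0 [simp]: "0 \<in> supported C"
  by (simp add: supported_def)

lemma supported_1: "graded C \<Longrightarrow> 1 \<in> supported C"
  by (simp add: supported_def graded_def)

lemma supported_add: "F \<in> supported C \<Longrightarrow> G \<in> supported C \<Longrightarrow> F + G \<in> supported C"
  unfolding supported_def using Poly_Mapping.keys_add by fastforce

lemma supported_uminus: "F \<in> supported C \<Longrightarrow> - F \<in> supported C"
  by (fastforce simp: supported_def in_keys_iff)

lemma supported_minus: "F \<in> supported C \<Longrightarrow> G \<in> supported C \<Longrightarrow> F - G \<in> supported C"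
  using supported_add[of F C "- G"] supported_uminus[of G C] by simp

lemma supported_sum: "(\<And>i. i \<in> I \<Longrightarrow> F i \<in> supported C) \<Longrightarrow> sum F I \<in> supported C"
  by (induction I rule: infinite_finite_induct) (auto intro: supported_add)

lemma keys_times_graded:
  assumes "graded C" "keys f \<subseteq> C M" "keys g \<subseteq> C N"
  shows "keys (f * g) \<subseteq> C (M + N)"
  using assms keys_mult[of f g] unfolding graded_def by blast

lemma keys_nth_times_graded:
  assumes "graded C" "\<And>i. i \<le> N \<Longrightarrow> keys (F $ i * G $ (N - i)) \<subseteq> C N"
  shows "keys ((F * G) $ N) \<subseteq> C N"
  unfolding fps_mult_nth using keys_sum[of "\<lambda>i. F $ i * G $ (N - i)" "{0..N}"] assms(2)
  by fastforce

lemma supported_times: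
  assumes "graded C" "F \<in> supported C" "G \<in> supported C"
  shows "F * G \<in> supported C"
proof -
  have "keys ((F * G) $ N) \<subseteq> C N" for N
  proof (rule keys_nth_times_graded[OF assms(1)])
    fix i assume "i \<le> N"
    then show "keys (F $ i * G $ (N - i)) \<subseteq> C N"
      using keys_times_graded[OF assms(1), of "F $ i" i "G $ (N - i)" "N - i"] assms(2,3)
      by (simp add: supported_def)
  qed
  then show ?thesis by (simp add: supported_def)
qed

lemma supported_prod:
  "graded C \<Longrightarrow> (\<And>i. i \<in> I \<Longrightarrow> F i \<in> supported C) \<Longrightarrow> prod F I \<in> supported C"
  by (induction I rule: infinite_finite_induct) (auto intro: supported_times supported_1)

lemma supported_weigh: "F \<in> supported C \<Longrightarrow> weigh w F \<in> supported C"
  unfolding supported_def using keys_weigh by blast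

lemma keys_minus_subset:
  fixes f g :: laurent
  assumes "keys f \<subseteq> B" "keys g \<subseteq> B"
  shows "keys (f - g) \<subseteq> B"
proof
  fix \<alpha> assume "\<alpha> \<in> keys (f - g)"
  then have "lookup f \<alpha> \<noteq> 0 \<or> lookup g \<alpha> \<noteq> 0"
    by (auto simp: in_keys_iff lookup_minus)
  with assms show "\<alpha> \<in> B" by (auto simp: in_keys_iff)
qed

text \<open>As \<open>Q $ 0 = 1\<close>, the equation expresses \<open>F $ N\<close> by
  \<open>P $ N\<close> and the products \<open>Q $ i * F $ (N - i)\<close> with i > 0, which allows
  strong induction on N.\<close>

lemma supported_quotient:
  assumes C: "graded C" and "P \<in> supported C" "Q \<in> supported C" "Q $ 0 = 1" and eq: "Q * F = P"
  shows "F \<in> supported C"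
proof -
  have "keys (F $ N) \<subseteq> C N" for N
  proof (induction N rule: less_induct)
    case (less N)
    have "P $ N = (\<Sum>i=0..N. Q $ i * F $ (N - i))"
      by (simp add: eq[symmetric] fps_mult_nth)
    also have "\<dots> = F $ N + (\<Sum>i=1..N. Q $ i * F $ (N - i))"
      by (simp add: sum.atLeast_Suc_atMost assms(4))
    finally have F: "F $ N = P $ N - (\<Sum>i=1..N. Q $ i * F $ (N - i))" by simp
    have "keys (Q $ i * F $ (N - i)) \<subseteq> C N" if "i \<in> {1..N}" for i
      using keys_times_graded[OF C, of "Q $ i" i "F $ (N - i)" "N - i"] less that assms(3)
      by (simp add: supported_def)
    then have "keys (\<Sum>i=1..N. Q $ i * F $ (N - i)) \<subseteq> C N"
      using keys_sum[of "\<lambda>i. Q $ i * F $ (N - i)" "{1..N}"] by fastforce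
    moreover have "keys (P $ N) \<subseteq> C N"
      using assms(2) by (simp add: supported_def)
    ultimately show ?case
      unfolding F by (rule keys_minus_subset[rotated])
  qed
  then show ?thesis by (simp add: supported_def)
qed

lemma supported_inverse:
  assumes "graded C" "F \<in> supported C" "F $ 0 = 0" "G * (1 - F) = 1"
  shows "G \<in> supported C"
proof (rule supported_quotient[OF assms(1)])
  show "(1 - F) * G = 1" using assms(4) by (simp only: mult.commute)
qed (use assms in \<open>simp_all add: supported_minus supported_1\<close>)

lemma ex_inverse_one_minus:
  fixes F :: "'a::comm_ring_1 fps"
  assumes "F $ 0 = 0"
  shows "\<exists>G. G * (1 - F) = 1"
  using fps_left_inverse[of 1 "1 - F"] assms by auto

section \<open>Constant terms, monomials and Euler derivations\<close>

definition ct :: "laurent fps \<Rightarrow> rat fps" where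
  "ct F = Abs_fps (\<lambda>N. lookup (F $ N) 0)"

definition scalar :: "rat \<Rightarrow> laurent fps" where
  "scalar r = fps_const (single 0 r)"

definition monom_fps :: "expo \<Rightarrow> laurent fps" where
  "monom_fps \<alpha> = fps_const (single \<alpha> 1)"

text \<open>The Euler derivation x_j d/dx_j. In contrast to d/dx_j it has the monomials as
  eigenvectors and never enlarges a support.\<close>

definition theta :: "nat \<Rightarrow> laurent fps \<Rightarrow> laurent fps" where
  "theta j = weigh (\<lambda>_ \<alpha>. of_int (lookup \<alpha> j))"

lemma ct_nth [simp]: "ct F $ N = lookup (F $ N) 0"
  by (simp add: ct_def)

lemma scalar_0 [simp]: "scalar 0 = 0" and scalar_1 [simp]: "scalar 1 = 1"
  by (simp_all add: scalar_def)

lemma scalar_add: "scalar (r + s) = scalar r + scalar s"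
  by (simp add: scalar_def single_add)

lemma scalar_times: "scalar (r * s) = scalar r * scalar s"
  by (simp add: scalar_def mult_single)

lemma scalar_uminus: "scalar (- r) = - scalar r"
  by (simp add: scalar_def single_uminus)

lemma scalar_of_int: "scalar (of_int k) = of_int k"
  by (simp add: scalar_def flip: fps_of_int)

lemma scalar_sum: "scalar (sum f I) = (\<Sum>i\<in>I. scalar (f i))"
  by (induction I rule: infinite_finite_induct) (simp_all add: scalar_add)

lemma scalar_prod: "scalar (prod f I) = (\<Prod>i\<in>I. scalar (f i))"
  by (induction I rule: infinite_finite_induct) (simp_all add: scalar_times)

lemma monom_fps_0 [simp]: "monom_fps 0 = 1"
  by (simp add: monom_fps_def)

lemma monom_fps_add: "monom_fps (\<alpha> + \<beta>) = monom_fps \<alpha> * monom_fps \<beta>"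
  by (simp add: monom_fps_def mult_single)

lemma monom_fps_sum: "monom_fps (sum f I) = (\<Prod>i\<in>I. monom_fps (f i))"
  by (induction I rule: infinite_finite_induct) (simp_all add: monom_fps_add)

lemma lookup_times_single:
  fixes f :: laurent
  shows "lookup (f * single \<beta> r) \<alpha> = lookup f (\<alpha> - \<beta>) * r"
proof -
  have "lookup (single \<beta> r * f) \<alpha> = r * lookup f (\<alpha> - \<beta>)"
    by (subst lookup_times_superset[where B = "{\<beta>}"]) auto
  then show ?thesis by (simp only: mult.commute)
qed

lemma lookup_times_monom_fps:
  "lookup ((F * monom_fps \<beta>) $ N) \<alpha> = lookup (F $ N) (\<alpha> - \<beta>)"
  by (simp add: monom_fps_def lookup_times_single)

lemma lookup_times_scalar:
  "lookup ((F * scalar r) $ N) \<alpha> = lookup (F $ N) \<alpha> * r"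
  by (simp add: scalar_def lookup_times_single)

lemma theta_add: "theta j (F + G) = theta j F + theta j G"
  by (simp add: theta_def weigh_add)

lemma theta_uminus: "theta j (- F) = - theta j F"
  using weigh_minus[of "\<lambda>_ \<alpha>. of_int (lookup \<alpha> j)" 0 F] by (simp add: theta_def)

lemma theta_0 [simp]: "theta j 0 = 0"
  by (simp add: theta_def)

lemma theta_times: "theta j (F * G) = theta j F * G + F * theta j G"
  unfolding theta_def by (rule weigh_times_deriv) (simp add: lookup_add)

lemma theta_monom_fps: "theta j (monom_fps \<alpha>) = scalar (of_int (lookup \<alpha> j)) * monom_fps \<alpha>"
  by (rule laurent_fps_eqI)
    (auto simp: theta_def monom_fps_def scalar_def mult_single lookup_single when_def
      simp del: single_of_int)

lemma theta_scalar [simp]: "theta j (scalar r) = 0"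
  by (rule laurent_fps_eqI) (auto simp: theta_def scalar_def lookup_single when_def)

lemma theta_1 [simp]: "theta j 1 = 0"
  using theta_scalar[of j 1] by simp

lemma theta_X_power [simp]: "theta j (fps_X ^ m) = 0"
  by (rule laurent_fps_eqI) (auto simp: theta_def fps_X_power_nth lookup_one when_def)

subsection \<open>Alternating sums\<close>

text \<open>The Leibniz formula for the determinant. With entries given by a function, a row is
  replaced by function update, on which the multilinear expansions below rely.\<close>

definition alt :: "nat \<Rightarrow> (nat \<Rightarrow> nat \<Rightarrow> 'a) \<Rightarrow> 'a::comm_ring_1" where
  "alt d R = (\<Sum>p | p permutes {..<d}. of_int (sign p) * (\<Prod>i<d. R i (p i)))"

lemma alt_cong: "(\<And>i j. i < d \<Longrightarrow> j < d \<Longrightarrow> R i j = R' i j) \<Longrightarrow> alt d R = alt d R'"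
  unfolding alt_def
  by (intro sum.cong refl arg_cong2[where f = times] prod.cong)
    (metis (full_types) lessThan_iff mem_Collect_eq permutes_in_image)

lemma prod_fun_upd:
  fixes R :: "nat \<Rightarrow> nat \<Rightarrow> 'a::comm_ring_1"
  assumes "k < d"
  shows "(\<Prod>i<d. (R(k := r)) i (p i)) = r (p k) * (\<Prod>i\<in>{..<d} - {k}. R i (p i))"
  using assms by (subst prod.remove[of _ k]) auto

lemma alt_row_add:
  "k < d \<Longrightarrow> alt d (R(k := \<lambda>j. r j + s j)) = alt d (R(k := r)) + alt d (R(k := s))"
  by (simp add: alt_def prod_fun_upd algebra_simps sum.distrib del: fun_upd_apply)

lemma alt_row_scale:
  "k < d \<Longrightarrow> alt d (R(k := \<lambda>j. c * r j)) = c * alt d (R(k := r))"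
  by (simp add: alt_def prod_fun_upd algebra_simps sum_distrib_left del: fun_upd_apply)

lemma alt_scale: "alt d (\<lambda>i j. s i * R i j) = (\<Prod>i<d. s i) * alt d R"
  by (simp add: alt_def prod.distrib sum_distrib_left algebra_simps)

lemma alt_scale_columns: "alt d (\<lambda>i j. R i j * s j) = alt d R * (\<Prod>i<d. s i)"
proof -
  have "(\<Prod>i<d. s (p i)) = (\<Prod>i<d. s i)" if "p permutes {..<d}" for p
    using prod.permute[OF that, of s] by (simp add: comp_def)
  then show ?thesis
    by (simp add: alt_def prod.distrib sum_distrib_left algebra_simps)
qed

lemma alt_diagonal: "alt d (\<lambda>i j. if i = j then e i else 0) = (\<Prod>i<d. e i)"
proof -
  have "alt d (\<lambda>i j. if i = j then e i else 0)
      = (\<Sum>p\<in>{id}. of_int (sign p) * (\<Prod>i<d. if i = p i then e i else 0))"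
    unfolding alt_def
  proof (rule sum.mono_neutral_right)
    show "\<forall>p\<in>{p. p permutes {..<d}} - {id}.
        of_int (sign p) * (\<Prod>i<d. if i = p i then e i else 0) = 0"
    proof
      fix p assume p: "p \<in> {p. p permutes {..<d}} - {id}"
      then obtain i where i: "p i \<noteq> i" by (auto simp: fun_eq_iff)
      with p have "i < d" by (metis Diff_iff lessThan_iff mem_Collect_eq permutes_not_in)
      with i have "(\<Prod>i<d. if i = p i then e i else 0) = 0"
        by (intro prod_zero bexI[of _ i]) auto
      then show "of_int (sign p) * (\<Prod>i<d. if i = p i then e i else 0) = 0" by simp
    qed
  qed (auto simp: finite_permutations permutes_id)
  then show ?thesis by (simp add: sign_id)
qed

text \<open>The rows in \<open>S\<close> add up to zero, so the indicator vector of \<open>S\<close>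
  is a nonzero kernel vector of the transposed matrix.\<close>

lemma alt_eq_0:
  fixes a :: "nat \<Rightarrow> nat \<Rightarrow> 'a::field"
  assumes "S \<subseteq> {..<d}" "S \<noteq> {}" and 0: "\<And>j. j < d \<Longrightarrow> (\<Sum>i\<in>S. a i j) = 0"
  shows "alt d a = 0"
proof -
  let ?A = "mat d d (\<lambda>(i, j). a i j)" and ?v = "vec d (\<lambda>i. if i \<in> S then 1 else 0 :: 'a)"
  have "transpose_mat ?A *\<^sub>v ?v = 0\<^sub>v d"
  proof (rule eq_vecI)
    fix j assume "j < dim_vec (0\<^sub>v d :: 'a vec)"
    then have j: "j < d" by simp
    have "(\<Sum>i = 0..<d. a i j * (if i \<in> S then 1 else 0)) = (\<Sum>i\<in>S. a i j)"
      using assms(1) by (intro sum.mono_neutral_cong_right) auto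
    with j show "vec_index (transpose_mat ?A *\<^sub>v ?v) j = vec_index (0\<^sub>v d) j"
      by (simp add: scalar_prod_def 0)
  qed simp
  moreover have "?v \<noteq> 0\<^sub>v d"
  proof
    assume v: "?v = 0\<^sub>v d"
    obtain i where i: "i \<in> S" "i < d" using assms by auto
    have "vec_index ?v i = vec_index (0\<^sub>v d) i" by (simp only: v)
    with i show False by simp
  qed
  ultimately have "det (transpose_mat ?A) = 0"
    by (subst det_0_iff_vec_prod_zero_field[of _ d]) (auto intro!: exI[of _ ?v])
  then have "det ?A = 0" by (simp add: det_transpose[of _ d])
  moreover have "det ?A = alt d a"
    unfolding alt_def by (subst det_def'[of _ d])
      (auto simp: atLeast0LessThan intro!: sum.cong prod.cong dest: permutes_in_image)
  ultimately show ?thesis by simp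
qed

lemma alt_scalar: "alt d (\<lambda>i j. scalar (a i j)) = scalar (alt d a)"
  by (simp add: alt_def scalar_sum scalar_prod scalar_times scalar_of_int)

lemma alt_row_scale':
  assumes "k < d" "\<And>j. j < d \<Longrightarrow> R k j = c * r j"
  shows "alt d R = c * alt d (R(k := r))"
  using assms by (subst alt_row_scale[symmetric]) (auto intro!: alt_cong)

section \<open>Constant terms of determinants of logarithmic derivatives\<close>

lemma laurent_eq_sum_single:
  fixes f :: laurent
  shows "f = (\<Sum>\<alpha>\<in>keys f. single \<alpha> (lookup f \<alpha>))"
  by (rule poly_mapping_eqI) (simp add: lookup_sum lookup_single when_def in_keys_iff)

lemma fps_eq_sum_shift:
  fixes F :: "'a::comm_ring_1 fps"
  shows "F = (\<Sum>m\<le>N. fps_X ^ m * fps_const (F $ m)) + fps_X ^ Suc N * fps_shift (Suc N) F"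
proof (rule fps_ext)
  fix k
  have "(fps_X ^ m * fps_const (F $ m)) $ k = (if k = m then F $ m else 0)" for m
    by (subst fps_X_power_mult_nth) auto
  then have "(\<Sum>m\<le>N. fps_X ^ m * fps_const (F $ m)) $ k = (\<Sum>m\<le>N. if k = m then F $ m else 0)"
    by (simp only: fps_sum_nth)
  then show "F $ k = ((\<Sum>m\<le>N. fps_X ^ m * fps_const (F $ m))
      + fps_X ^ Suc N * fps_shift (Suc N) F) $ k"
    by (auto simp: fps_X_power_mult_nth simp del: power_Suc)
qed

lemma fps_const_sum: "fps_const (sum f A) = (\<Sum>x\<in>A. fps_const (f x))"
  by (induction A rule: infinite_finite_induct)
    (simp_all flip: fps_const_add)

text \<open>The shift by \<open>n\<close> selects the unknowns. The parameter \<epsilon> allows a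
  row to be split linearly into its identity part (\<open>g = 0\<close>) and pieces of
  \<open>g\<close> (\<epsilon> = 0).\<close>

definition log_row :: "nat \<Rightarrow> nat \<Rightarrow> rat \<Rightarrow> laurent fps \<Rightarrow> nat \<Rightarrow> laurent fps" where
  "log_row n i \<epsilon> g j = (if i = j then scalar \<epsilon> else 0) + theta (n + j) g"

abbreviation coefficient_part :: "nat \<Rightarrow> laurent fps set" where
  "coefficient_part n \<equiv> supported (\<lambda>_. {\<alpha>. keys \<alpha> \<subseteq> {..<n}})"

text \<open>
  Rows \<open>\<theta> x\<^sup>\<alpha>\<close> are multiples of the vector \<open>\<alpha>\<close>, and a product of such rows contributes to the
  constant term only if these vectors sum to zero; but then they are linearly dependent.
\<close>

lemma ct_alt_log_row_monomials:
  assumes c: "c \<in> coefficient_part n"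
    and atom: "\<And>i. i < d \<Longrightarrow> g i = 0 \<or>
      \<epsilon> i = 0 \<and> (\<exists>m \<alpha> r. g i = fps_X ^ m * fps_const (single \<alpha> r))"
  shows "lookup ((c * alt d (\<lambda>i. log_row n i (\<epsilon> i) (g i))) $ N) 0
    = (\<Prod>i<d. \<epsilon> i) * lookup (c $ N) 0"
proof (cases "\<forall>i<d. g i = 0")
  case True
  have "alt d (\<lambda>i. log_row n i (\<epsilon> i) (g i)) = alt d (\<lambda>i j. if i = j then scalar (\<epsilon> i) else 0)"
    using True by (intro alt_cong) (simp add: log_row_def)
  also have "\<dots> = scalar (\<Prod>i<d. \<epsilon> i)"
    by (simp only: alt_diagonal scalar_prod)
  finally show ?thesis by (simp add: lookup_times_scalar)
next
  case False
  define S where "S = {i. i < d \<and> g i \<noteq> 0}"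
  have S: "S \<subseteq> {..<d}" "S \<noteq> {}" using False by (auto simp: S_def)
  have "\<forall>i. \<exists>m \<alpha> r. i \<in> S \<longrightarrow> g i = fps_X ^ m * fps_const (single \<alpha> r)" and \<epsilon>: "\<forall>i\<in>S. \<epsilon> i = 0"
    using atom by (auto simp: S_def)
  then obtain m \<alpha> r where g: "\<And>i. i \<in> S \<Longrightarrow> g i = fps_X ^ m i * fps_const (single (\<alpha> i) (r i))"
    by metis
  define s where "s i = (if i \<in> S then fps_X ^ m i * scalar (r i) * monom_fps (\<alpha> i) else 1)" for i
  define a where
    "a i j = (if i \<in> S then of_int (lookup (\<alpha> i) (n + j)) else if i = j then \<epsilon> i else 0)" for i j
  define M where "M = (\<Sum>i\<in>S. m i)"
  define \<beta> where "\<beta> = (\<Sum>i\<in>S. \<alpha> i)"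
  have "log_row n i (\<epsilon> i) (g i) j = s i * scalar (a i j)" if "i < d" for i j
  proof (cases "i \<in> S")
    case True
    have "fps_const (single (\<alpha> i) (r i)) = scalar (r i) * monom_fps (\<alpha> i)"
      by (simp add: scalar_def monom_fps_def mult_single)
    then show ?thesis
      using True \<epsilon> by (simp add: log_row_def s_def a_def g theta_times theta_monom_fps algebra_simps)
  next
    case False
    then show ?thesis using that by (auto simp: S_def log_row_def s_def a_def)
  qed
  then have "alt d (\<lambda>i. log_row n i (\<epsilon> i) (g i)) = alt d (\<lambda>i j. s i * scalar (a i j))"
    by (intro alt_cong)
  also have "\<dots> = (\<Prod>i<d. s i) * scalar (alt d a)"
    by (simp only: alt_scale alt_scalar)
  also have "(\<Prod>i<d. s i) = (\<Prod>i\<in>S. fps_X ^ m i * scalar (r i) * monom_fps (\<alpha> i))"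
    using S by (intro prod.mono_neutral_cong_right) (auto simp: s_def)
  also have "\<dots> = fps_X ^ M * scalar (prod r S) * monom_fps \<beta>"
    by (simp add: prod.distrib M_def \<beta>_def power_sum scalar_prod monom_fps_sum)
  finally have alt: "c * alt d (\<lambda>i. log_row n i (\<epsilon> i) (g i))
      = fps_X ^ M * (c * scalar (prod r S * alt d a) * monom_fps \<beta>)"
    by (simp add: scalar_times algebra_simps)
  have "lookup ((c * alt d (\<lambda>i. log_row n i (\<epsilon> i) (g i))) $ N) 0 = 0"
  proof (cases "N < M \<or> lookup (c $ (N - M)) (- \<beta>) = 0")
    case True
    then show ?thesis
      unfolding alt fps_X_power_mult_nth by (auto simp: lookup_times_monom_fps lookup_times_scalar)
  next
    case False
    then have "- \<beta> \<in> keys (c $ (N - M))" by (simp add: in_keys_iff)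
    then have "keys (- \<beta>) \<subseteq> {..<n}" using c unfolding supported_def by blast
    then have "lookup \<beta> (n + j) = 0" for j by (auto simp: in_keys_iff subset_iff)
    then have "(\<Sum>i\<in>S. of_int (lookup (\<alpha> i) (n + j)) :: rat) = 0" for j
      by (simp add: \<beta>_def lookup_sum flip: of_int_sum)
    then have "alt d a = 0"
      by (intro alt_eq_0[OF S]) (simp add: a_def)
    then show ?thesis unfolding alt by simp
  qed
  moreover have "(\<Prod>i<d. \<epsilon> i) = 0" using S \<epsilon> by (auto intro!: prod_zero)
  ultimately show ?thesis by simp
qed

text \<open>Induction on \<open>k\<close>, the number of leading rows that are still arbitrary. By
  multilinearity such a row is expanded into its identity part, finitely many monomials and a tail
  divisible by \<open>fps_X ^ Suc N\<close>. Once all rows are of these kinds, a tail makes the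
  coefficient at \<open>N\<close> vanish, and without tails the monomial case applies.\<close>

lemma ct_alt_log_row_aux:
  assumes c: "c \<in> coefficient_part n"
    and "k \<le> d"
    and atom: "\<And>i. k \<le> i \<Longrightarrow> i < d \<Longrightarrow> g i = 0 \<or>
      \<epsilon> i = 0 \<and> ((\<exists>m \<alpha> r. g i = fps_X ^ m * fps_const (single \<alpha> r)) \<or>
        (\<exists>h. g i = fps_X ^ Suc N * h))"
  shows "lookup ((c * alt d (\<lambda>i. log_row n i (\<epsilon> i) (g i))) $ N) 0
    = (\<Prod>i<d. \<epsilon> i) * lookup (c $ N) 0"
  using assms(2-)
proof (induction k arbitrary: \<epsilon> g)
  case 0
  show ?case
  proof (cases "\<exists>i<d. \<epsilon> i = 0 \<and> (\<exists>h. g i = fps_X ^ Suc N * h)")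
    case True
    then obtain i h where i: "i < d" "\<epsilon> i = 0" and g: "g i = fps_X ^ Suc N * h" by blast
    define R where "R = (\<lambda>i. log_row n i (\<epsilon> i) (g i))"
    have "R i j = fps_X ^ Suc N * theta (n + j) h" for j
      by (simp add: R_def log_row_def g i theta_times del: power_Suc)
    then have "alt d R = fps_X ^ Suc N * alt d (R(i := \<lambda>j. theta (n + j) h))"
      by (rule alt_row_scale'[OF i(1)])
    then have "c * alt d R = fps_X ^ Suc N * (c * alt d (R(i := \<lambda>j. theta (n + j) h)))"
      by (simp only: mult_ac)
    then have "lookup ((c * alt d R) $ N) 0 = 0"
      by (simp only: fps_X_power_mult_nth) simp
    moreover have "(\<Prod>i<d. \<epsilon> i) = 0" using i by (auto intro!: prod_zero)
    ultimately show ?thesis by (simp add: R_def)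
  next
    case False
    then show ?thesis using 0 by (intro ct_alt_log_row_monomials[OF c]) blast
  qed
next
  case (Suc k)
  have k: "k < d" using Suc.prems by simp
  define R where "R = (\<lambda>i. log_row n i (\<epsilon> i) (g i))"
  \<comment> \<open>The claim with row \<open>k\<close> replaced by the row of the pair (\<delta>,
    h). Both sides are additive in the pair, so it can be checked on pieces.\<close>
  define V where "V \<delta> h \<longleftrightarrow> lookup ((c * alt d (R(k := log_row n k \<delta> h))) $ N) 0
      = \<delta> * (\<Prod>i\<in>{..<d} - {k}. \<epsilon> i) * lookup (c $ N) 0" for \<delta> h
  have add: "V (\<delta> + \<delta>') (h + h')" if "V \<delta> h" "V \<delta>' h'" for \<delta> \<delta>' h h'
  proof -
    have "log_row n k (\<delta> + \<delta>') (h + h') = (\<lambda>j. log_row n k \<delta> h j + log_row n k \<delta>' h' j)"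
      by (auto simp: fun_eq_iff log_row_def theta_add scalar_add)
    then have "alt d (R(k := log_row n k (\<delta> + \<delta>') (h + h')))
        = alt d (R(k := log_row n k \<delta> h)) + alt d (R(k := log_row n k \<delta>' h'))"
      by (simp only: alt_row_add[OF k])
    with that show ?thesis
      by (simp add: V_def distrib_left distrib_right lookup_add)
  qed
  have atomic: "V \<delta> h" if "h = 0 \<or> \<delta> = 0 \<and> ((\<exists>m \<alpha> r. h = fps_X ^ m * fps_const (single \<alpha> r)) \<or>
      (\<exists>h'. h = fps_X ^ Suc N * h'))" for \<delta> h
  proof -
    let ?\<epsilon> = "\<epsilon>(k := \<delta>)" and ?g = "g(k := h)"
    have "(\<lambda>i. log_row n i (?\<epsilon> i) (?g i)) = R(k := log_row n k \<delta> h)"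
      by (auto simp: R_def)
    moreover have "(\<Prod>i<d. ?\<epsilon> i) = \<delta> * (\<Prod>i\<in>{..<d} - {k}. \<epsilon> i)"
      using k by (subst prod.remove[of _ k]) auto
    moreover have "lookup ((c * alt d (\<lambda>i. log_row n i (?\<epsilon> i) (?g i))) $ N) 0
        = (\<Prod>i<d. ?\<epsilon> i) * lookup (c $ N) 0"
    proof (rule Suc.IH)
      show "k \<le> d" using k by simp
      fix i assume "k \<le> i" "i < d"
      then show "?g i = 0 \<or> ?\<epsilon> i = 0 \<and> ((\<exists>m \<alpha> r. ?g i = fps_X ^ m * fps_const (single \<alpha> r)) \<or>
          (\<exists>h. ?g i = fps_X ^ Suc N * h))"
        using that Suc.prems(2)[of i] by (cases "i = k") auto
    qed
    ultimately show ?thesis by (simp add: V_def)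
  qed
  have sum: "V 0 (sum H A)" if "\<And>x. x \<in> A \<Longrightarrow> V 0 (H x)" for H :: "'x \<Rightarrow> laurent fps" and A
    using that by (induction A rule: infinite_finite_induct) (use add[of 0 _ 0] atomic in auto)
  have "V 0 (fps_X ^ m * fps_const f)" for m f
  proof -
    have "fps_X ^ m * fps_const f = (\<Sum>\<alpha>\<in>keys f. fps_X ^ m * fps_const (single \<alpha> (lookup f \<alpha>)))"
      by (subst laurent_eq_sum_single[of f]) (simp only: fps_const_sum sum_distrib_left)
    also have "V 0 \<dots>" by (rule sum) (auto intro!: atomic)
    finally show ?thesis .
  qed
  then have low: "V 0 (\<Sum>m\<le>N. fps_X ^ m * fps_const (g k $ m))" by (rule sum)
  have high: "V 0 (fps_X ^ Suc N * fps_shift (Suc N) (g k))" by (rule atomic) blast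
  have "V 0 ((\<Sum>m\<le>N. fps_X ^ m * fps_const (g k $ m)) + fps_X ^ Suc N * fps_shift (Suc N) (g k))"
    using add[OF low high] by (simp only: add_0_left)
  then have "V 0 (g k)" by (simp only: fps_eq_sum_shift[symmetric])
  \<comment> \<open>The pair splits as (\<epsilon> k, 0) + (0, g k).\<close>
  then have "V (\<epsilon> k) (g k)"
    using add[of "\<epsilon> k" 0 0 "g k"] atomic[of 0 "\<epsilon> k"] by simp
  moreover have "R(k := log_row n k (\<epsilon> k) (g k)) = R" by (auto simp: R_def)
  moreover have "\<epsilon> k * (\<Prod>i\<in>{..<d} - {k}. \<epsilon> i) = (\<Prod>i<d. \<epsilon> i)"
    using k by (subst (2) prod.remove[of _ k]) auto
  ultimately show ?case by (simp add: V_def R_def)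
qed

text \<open>The matrix is the logarithmic Jacobian of the formal substitution y_i -> y_i exp(g_i);
  this is the invariance of residues under a change of variables, in constant-term form.\<close>

lemma ct_alt_log_row:
  assumes "c \<in> coefficient_part n"
  shows "ct (c * alt d (\<lambda>i. log_row n i 1 (g i))) = ct c"
  using ct_alt_log_row_aux[OF assms, of d d] by (auto intro!: fps_ext)

lemma theta_inverse:
  assumes "H * (1 - F) = 1"
  shows "theta j H = theta j F * H * H"
proof -
  have "theta j (H * (1 - F)) = 0" by (simp add: assms)
  then have "theta j H * (1 - F) = H * theta j F"
    using theta_add[of j 1 "- F"] by (simp add: theta_times theta_uminus)
  then have "theta j H * (H * (1 - F)) = H * theta j F * H"
    by (simp add: mult_ac)
  then show ?thesis by (simp add: assms mult_ac)
qed

text \<open>The logarithm is found by integrating the Euler derivative in the grading variable.\<close>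

lemma ex_log:
  assumes F: "F $ 0 = 0" and H: "H * (1 - F) = 1"
  shows "\<exists>g. \<forall>j. theta j g = theta j F * H"
proof -
  define \<delta> where "\<delta> = weigh (\<lambda>N _. of_nat N)"
  \<comment> \<open>This is -log(1 - F). At N = 0 the weight is 1 / 0 = 0, which loses nothing
    because \<delta> F has no coefficient there.\<close>
  define g where "g = weigh (\<lambda>N _. 1 / of_nat N) (\<delta> F * H)"
  have \<delta>_times: "\<delta> (A * B) = \<delta> A * B + A * \<delta> B" for A B
    unfolding \<delta>_def by (rule weigh_times_deriv) simp
  have \<delta>_theta: "\<delta> (theta j A) = theta j (\<delta> A)" for j A
    unfolding \<delta>_def theta_def by (rule weigh_commute)
  have \<delta>0: "\<delta> A $ 0 = 0" for A
    by (rule poly_mapping_eqI) (simp add: \<delta>_def)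
  have "\<delta> (H * (1 - F)) = 0"
    unfolding H by (rule laurent_fps_eqI) (auto simp: \<delta>_def)
  then have "\<delta> H * (1 - F) = H * \<delta> F"
    using \<delta>_times[of H "1 - F"] weigh_minus[of _ 1 F] H
    by (simp add: \<delta>_def algebra_simps) (simp add: laurent_fps_eqI)
  then have "\<delta> H * (H * (1 - F)) = H * \<delta> F * H"
    by (simp add: mult_ac)
  then have \<delta>H: "\<delta> H = \<delta> F * H * H" by (simp add: H mult_ac)
  have \<delta>g: "\<delta> g = \<delta> F * H"
  proof (rule laurent_fps_eqI)
    fix N \<alpha>
    have "lookup ((\<delta> F * H) $ 0) \<alpha> = 0" by (simp add: \<delta>0)
    then show "lookup (\<delta> g $ N) \<alpha> = lookup ((\<delta> F * H) $ N) \<alpha>"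
      by (cases N) (auto simp: \<delta>_def g_def)
  qed
  \<comment> \<open>The operator \<delta> determines a series up to its coefficient in degree
    0.\<close>
  have eqI: "A = B" if "\<delta> A = \<delta> B" "A $ 0 = B $ 0" for A B
  proof (rule laurent_fps_eqI)
    fix N \<alpha>
    have "lookup (\<delta> A $ N) \<alpha> = lookup (\<delta> B $ N) \<alpha>" by (simp add: that)
    then show "lookup (A $ N) \<alpha> = lookup (B $ N) \<alpha>"
      using that(2) by (cases N) (auto simp: \<delta>_def)
  qed
  have theta0: "theta j A $ 0 = 0" if "A $ 0 = 0" for j A
    by (rule poly_mapping_eqI) (simp add: theta_def that)
  have "theta j g = theta j F * H" for j
  proof (rule eqI)
    have "\<delta> (theta j g) = theta j (\<delta> F) * H + \<delta> F * (theta j F * H * H)"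
      by (simp add: \<delta>_theta \<delta>g theta_times theta_inverse[OF H])
    also have "\<dots> = \<delta> (theta j F * H)"
      by (simp add: \<delta>_times \<delta>_theta \<delta>H mult_ac)
    finally show "\<delta> (theta j g) = \<delta> (theta j F * H)" .
    have "g $ 0 = 0" by (rule poly_mapping_eqI) (simp add: g_def)
    then show "theta j g $ 0 = (theta j F * H) $ 0" by (simp add: theta0 F)
  qed
  then show ?thesis by blast
qed

section \<open>Laurent polynomials and rational series with bounded negative exponents\<close>

definition box :: "nat \<Rightarrow> nat \<Rightarrow> expo set" where
  "box v N = {\<alpha>. keys \<alpha> \<subseteq> {..<v} \<and> (\<forall>i. - int N \<le> lookup \<alpha> i)}"

text \<open>Each coefficient has finitely many terms by its type, so a bound on the degree in
  \<open>X\<close> is all that a Laurent polynomial needs.\<close>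

definition lpolys :: "nat \<Rightarrow> laurent fps set" where
  "lpolys v = {F \<in> supported (box v). \<exists>D. \<forall>N>D. F $ N = 0}"

text \<open>The normalisation \<open>Q $ 0 = 1\<close> makes \<open>Q\<close> invertible and forces
  the quotient into \<open>supported (box v)\<close> as well, by
  \<open>supported_quotient\<close>.\<close>

definition lrational :: "nat \<Rightarrow> laurent fps \<Rightarrow> bool" where
  "lrational v F \<longleftrightarrow> (\<exists>P\<in>lpolys v. \<exists>Q\<in>lpolys v. Q $ 0 = 1 \<and> Q * F = P)"

lemma graded_box: "graded (box v)"
  unfolding graded_def
proof (intro conjI allI ballI)
  fix M N \<alpha> \<beta> assume *: "\<alpha> \<in> box v M" "\<beta> \<in> box v N"
  have "- int (M + N) \<le> lookup (\<alpha> + \<beta>) i" for i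
    using * by (auto simp: box_def lookup_add dest!: spec[of _ i])
  moreover have "keys (\<alpha> + \<beta>) \<subseteq> {..<v}"
    using * Poly_Mapping.keys_add[of \<alpha> \<beta>] unfolding box_def by blast
  ultimately show "\<alpha> + \<beta> \<in> box v (M + N)" by (simp add: box_def)
qed (simp add: box_def)

lemma lpolys_times:
  assumes "F \<in> lpolys v" "G \<in> lpolys v"
  shows "F * G \<in> lpolys v"
proof -
  obtain D E where D: "\<And>N. N > D \<Longrightarrow> F $ N = 0" and E: "\<And>N. N > E \<Longrightarrow> G $ N = 0"
    using assms unfolding lpolys_def by blast
  have "(F * G) $ N = 0" if "N > D + E" for N
    unfolding fps_mult_nth
  proof (rule sum.neutral, rule ballI)
    fix i assume "i \<in> {0..N}"
    show "F $ i * G $ (N - i) = 0"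
      using D[of i] E[of "N - i"] that by (cases "i > D") auto
  qed
  then show ?thesis
    using assms supported_times[OF graded_box] by (auto simp: lpolys_def)
qed

lemma lpolys_add: "F \<in> lpolys v \<Longrightarrow> G \<in> lpolys v \<Longrightarrow> F + G \<in> lpolys v"
  unfolding lpolys_def
proof clarsimp
  fix D E
  assume "\<forall>N>D. F $ N = 0" "\<forall>N>E. G $ N = 0" "F \<in> supported (box v)" "G \<in> supported (box v)"
  then show "F + G \<in> supported (box v) \<and> (\<exists>D. \<forall>N>D. F $ N + G $ N = 0)"
    by (auto intro!: supported_add exI[of _ "max D E"])
qed

lemma lpolys_uminus: "F \<in> lpolys v \<Longrightarrow> - F \<in> lpolys v"
  by (auto simp: lpolys_def supported_uminus)

lemma lpolys_minus: "F \<in> lpolys v \<Longrightarrow> G \<in> lpolys v \<Longrightarrow> F - G \<in> lpolys v"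
  using lpolys_add[of F v "- G"] lpolys_uminus[of G v] by simp

lemma lpolys_0 [simp]: "0 \<in> lpolys v"
  by (simp add: lpolys_def)

lemma lpolys_1 [simp]: "1 \<in> lpolys v"
  by (auto simp: lpolys_def supported_1[OF graded_box])

lemma lpolys_sum: "(\<And>i. i \<in> I \<Longrightarrow> F i \<in> lpolys v) \<Longrightarrow> sum F I \<in> lpolys v"
  by (induction I rule: infinite_finite_induct) (auto intro: lpolys_add)

lemma lpolys_prod: "(\<And>i. i \<in> I \<Longrightarrow> F i \<in> lpolys v) \<Longrightarrow> prod F I \<in> lpolys v"
  by (induction I rule: infinite_finite_induct) (auto intro: lpolys_times)

lemma lpolys_weigh: "F \<in> lpolys v \<Longrightarrow> weigh w F \<in> lpolys v"
  unfolding lpolys_def by (auto simp: supported_weigh) (metis keys_eq_empty keys_weigh subset_empty)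

lemma lpolys_of_int: "of_int k \<in> lpolys v"
proof -
  have n: "of_nat m \<in> lpolys v" for m
    by (induction m) (auto intro: lpolys_add)
  have "of_int k = (of_nat (nat k) :: laurent fps) - of_nat (nat (- k))"
    by (cases "k \<ge> 0") simp_all
  then show ?thesis by (simp only: lpolys_minus n)
qed

lemma lpolys_alt:
  assumes "\<And>i j. i < d \<Longrightarrow> j < d \<Longrightarrow> R i j \<in> lpolys v"
  shows "alt d R \<in> lpolys v"
  unfolding alt_def
proof (intro lpolys_sum lpolys_times lpolys_prod lpolys_of_int)
  fix p i assume "p \<in> {p. p permutes {..<d}}" "i \<in> {..<d}"
  then show "R i (p i) \<in> lpolys v"
    using permutes_in_image[of p "{..<d}" i] by (intro assms) auto
qed

subsection \<open>Sections of rational series\<close>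

definition double :: "expo \<Rightarrow> expo" where
  "double \<alpha> = \<alpha> + \<alpha>"

lemma lookup_double [simp]: "lookup (double \<alpha>) i = 2 * lookup \<alpha> i"
  by (simp only: double_def lookup_add mult_2)

lemma inj_double: "inj double"
proof (rule injI)
  fix \<alpha> \<beta> assume "double \<alpha> = double \<beta>"
  then have "2 * lookup \<alpha> i = 2 * lookup \<beta> i" for i
    by (simp only: flip: lookup_double)
  then show "\<alpha> = \<beta>" by (intro poly_mapping_eqI) simp
qed

lemma double_0 [simp]: "double 0 = 0"
  by (simp add: double_def)

lemma double_minus: "double (\<alpha> - \<beta>) = double \<alpha> - double \<beta>"
  by (rule poly_mapping_eqI) (simp add: lookup_minus)

text \<open>The exponents of \<open>X\<close> and of all Laurent variables are halved together. Then
  \<open>box\<close> is preserved, as -2N <= 2a is equivalent to -N <= a; a section in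
  \<open>X\<close> alone would break this bound.\<close>

definition half :: "laurent fps \<Rightarrow> laurent fps" where
  "half F = Abs_fps (\<lambda>N. Poly_Mapping.map_key double (F $ (2 * N)))"

lemma lookup_half [simp]: "lookup (half F $ N) \<alpha> = lookup (F $ (2 * N)) (double \<alpha>)"
  by (simp add: half_def map_key.rep_eq inj_double)

definition even_supp :: "laurent fps \<Rightarrow> bool" where
  "even_supp F \<longleftrightarrow> (\<forall>N. \<forall>\<alpha>\<in>keys (F $ N). even N \<and> (\<exists>\<beta>. \<alpha> = double \<beta>))"

text \<open>\<open>half\<close> is linear over series in the squares of all variables: a term of the
  product with even exponents that uses an even term of \<open>Q\<close> also uses an even term of
  \<open>F\<close>.\<close>

lemma half_times:
  assumes "even_supp Q"
  shows "half (Q * F) = half Q * half F"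
proof (rule laurent_fps_eqI)
  fix N \<alpha>
  let ?t = "\<lambda>(i, \<beta>). lookup (Q $ i) \<beta> * lookup (F $ (2 * N - i)) (double \<alpha> - \<beta>)"
  let ?A = "Sigma {..N} (\<lambda>i. keys (half Q $ i))"
  let ?h = "\<lambda>(i, \<beta>). (2 * i, double \<beta>)"
  have inj: "inj_on ?h ?A"
    using inj_double by (auto simp: inj_on_def)
  have im: "?h ` ?A = Sigma {..2 * N} (\<lambda>i. keys (Q $ i))"
  proof
    show "?h ` ?A \<subseteq> Sigma {..2 * N} (\<lambda>i. keys (Q $ i))"
      by (auto simp: in_keys_iff)
    show "Sigma {..2 * N} (\<lambda>i. keys (Q $ i)) \<subseteq> ?h ` ?A"
    proof (rule subsetI)
      fix x assume "x \<in> Sigma {..2 * N} (\<lambda>i. keys (Q $ i))"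
      then obtain i \<beta> where x: "x = (i, \<beta>)" and *: "i \<le> 2 * N" "\<beta> \<in> keys (Q $ i)"
        by auto
      with assms obtain j \<gamma> where "i = 2 * j" "\<beta> = double \<gamma>"
        unfolding even_supp_def by (meson evenE)
      with * x show "x \<in> ?h ` ?A"
        by (intro image_eqI[of _ _ "(j, \<gamma>)"]) (auto simp: in_keys_iff)
    qed
  qed
  have "lookup (half (Q * F) $ N) \<alpha> = sum ?t (Sigma {..2 * N} (\<lambda>i. keys (Q $ i)))"
    by (simp add: coeff_times_superset[where B = "\<lambda>i. keys (Q $ i)"] sum.Sigma)
  also have "\<dots> = sum (?t \<circ> ?h) ?A"
    unfolding im[symmetric] by (rule sum.reindex[OF inj])
  also have "\<dots> = (\<Sum>(i, \<beta>)\<in>?A. lookup (half Q $ i) \<beta> * lookup (half F $ (N - i)) (\<alpha> - \<beta>))"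
    by (intro sum.cong) (auto simp: double_minus diff_mult_distrib2)
  also have "\<dots> = lookup ((half Q * half F) $ N) \<alpha>"
    by (simp add: coeff_times_superset[where B = "\<lambda>i. keys (half Q $ i)"] sum.Sigma
        del: lookup_half)
  finally show "lookup (half (Q * F) $ N) \<alpha> = lookup ((half Q * half F) $ N) \<alpha>" .
qed

lemma keys_double: "keys (double \<alpha>) = keys \<alpha>"
  by (auto simp: in_keys_iff)

lemma half_lpolys:
  assumes "F \<in> lpolys v"
  shows "half F \<in> lpolys v"
proof -
  obtain D where D: "\<And>N. N > D \<Longrightarrow> F $ N = 0" and s: "\<And>N. keys (F $ N) \<subseteq> box v N"
    using assms by (auto simp: lpolys_def supported_def)
  have "keys (half F $ N) \<subseteq> box v N" for N
  proof
    fix \<alpha> assume "\<alpha> \<in> keys (half F $ N)"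
    then have *: "double \<alpha> \<in> box v (2 * N)" using s[of "2 * N"] by (auto simp: in_keys_iff)
    have "- int N \<le> lookup \<alpha> i" for i
      using * by (auto simp: box_def dest!: spec[of _ i])
    with * show "\<alpha> \<in> box v N" by (simp add: box_def keys_double)
  qed
  moreover have "half F $ N = 0" if "N > D" for N
    by (rule poly_mapping_eqI) (use D[of "2 * N"] that in simp)
  ultimately show ?thesis by (auto simp: lpolys_def supported_def)
qed

text \<open>Index 0 is the sign change of \<open>X\<close>, and index k > 0 that of the Laurent
  variable k - 1; for \<open>v\<close> Laurent variables the indices are 0, ..., v.\<close>

definition sign_char :: "nat \<Rightarrow> nat \<Rightarrow> expo \<Rightarrow> rat" where
  "sign_char k N \<alpha> = (if k = 0 then (- 1) ^ N else if even (lookup \<alpha> (k - 1)) then 1 else - 1)"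

lemma sign_char_hom: "sign_char k (M + N) (\<alpha> + \<beta>) = sign_char k M \<alpha> * sign_char k N \<beta>"
  by (auto simp: sign_char_def power_add lookup_add)

lemma sign_char_square: "sign_char k N \<alpha> * sign_char k N \<alpha> = 1"
  by (auto simp: sign_char_def simp flip: power_mult_distrib)

lemma weigh_sign_char_twice: "weigh (sign_char k) (weigh (sign_char k) F) = F"
  by (rule laurent_fps_eqI) (simp add: sign_char_square flip: mult.assoc)

lemma weigh_sign_char_times:
  "weigh (sign_char k) (F * G) = weigh (sign_char k) F * weigh (sign_char k) G"
  by (rule weigh_times_hom) (rule sign_char_hom)

lemma weigh_sign_char_0:
  assumes "F $ 0 = 1"
  shows "weigh (sign_char k) F $ 0 = 1"
  by (rule poly_mapping_eqI) (auto simp: assms lookup_one sign_char_def when_def)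

text \<open>A norm construction: multiplying \<open>R * Q\<close> by its conjugate under the sign
  change \<open>k\<close> makes it invariant under \<open>k\<close>, and the earlier invariances
  survive because sign changes commute.\<close>

lemma ex_sign_invariant_multiple:
  assumes "Q \<in> lpolys v" "Q $ 0 = 1"
  shows "\<exists>R\<in>lpolys v. R $ 0 = 1 \<and> (\<forall>i<k. weigh (sign_char i) (R * Q) = R * Q)"
proof (induction k)
  case 0
  show ?case by (intro bexI[of _ 1]) auto
next
  case (Suc k)
  then obtain R where R: "R \<in> lpolys v" "R $ 0 = 1"
    "\<And>i. i < k \<Longrightarrow> weigh (sign_char i) (R * Q) = R * Q" by blast
  let ?R = "R * weigh (sign_char k) (R * Q)"
  have eq: "?R * Q = (R * Q) * weigh (sign_char k) (R * Q)" by (simp add: mult_ac)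
  have "weigh (sign_char i) (?R * Q) = ?R * Q" if "i < Suc k" for i
  proof (cases "i = k")
    case True
    show ?thesis
      unfolding eq weigh_sign_char_times[of i "R * Q"] unfolding True weigh_sign_char_twice
      by (rule mult.commute)
  next
    case False
    with that have i: "weigh (sign_char i) (R * Q) = R * Q" by (intro R) simp
    show ?thesis
      unfolding eq weigh_sign_char_times[of i "R * Q"]
      by (subst weigh_commute) (simp only: i)
  qed
  moreover have "?R $ 0 = 1"
    using R(2) assms(2) weigh_sign_char_0[of "R * Q" k] by simp
  moreover have "?R \<in> lpolys v"
    using R(1) assms(1) by (intro lpolys_times lpolys_weigh)
  ultimately show ?case by blast
qed

lemma sign_invariant_nonzero:
  assumes "weigh (sign_char k) F = F" "\<alpha> \<in> keys (F $ N)"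
  shows "sign_char k N \<alpha> = 1"
proof -
  have "sign_char k N \<alpha> * lookup (F $ N) \<alpha> = lookup (F $ N) \<alpha>"
    by (metis assms(1) lookup_weigh)
  with assms(2) show ?thesis by (simp add: in_keys_iff)
qed

text \<open>An invariant series has no term on which a sign character is -1; variables from
  \<open>v\<close> on do not occur at all.\<close>

lemma even_supp_if_sign_invariant:
  assumes F: "F \<in> lpolys v" and inv: "\<And>k. k \<le> v \<Longrightarrow> weigh (sign_char k) F = F"
  shows "even_supp F"
  unfolding even_supp_def
proof (intro allI ballI conjI)
  fix N \<alpha> assume \<alpha>: "\<alpha> \<in> keys (F $ N)"
  have "(- 1 :: rat) ^ N = 1"
    using sign_invariant_nonzero[OF inv[of 0] \<alpha>] by (simp add: sign_char_def)
  then show "even N" by (cases "even N") auto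
  have even: "even (lookup \<alpha> i)" for i
  proof (cases "i < v")
    case True
    then show ?thesis
      using sign_invariant_nonzero[OF inv[of "Suc i"] \<alpha>] by (auto simp: sign_char_def split: if_splits)
  next
    case False
    have "keys \<alpha> \<subseteq> {..<v}" using F \<alpha> by (auto simp: lpolys_def supported_def box_def)
    with False have "i \<notin> keys \<alpha>" by auto
    then show ?thesis by (simp add: in_keys_iff)
  qed
  have "\<alpha> = double (Poly_Mapping.map (\<lambda>x. x div 2) \<alpha>)"
  proof (rule poly_mapping_eqI)
    fix i
    have "lookup (Poly_Mapping.map (\<lambda>x. x div 2) \<alpha>) i = lookup \<alpha> i div 2"
      by (simp add: map.rep_eq when_def)
    then show "lookup \<alpha> i = lookup (double (Poly_Mapping.map (\<lambda>x. x div 2) \<alpha>)) i"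
      using even[of i] by auto
  qed
  then show "\<exists>\<beta>. \<alpha> = double \<beta>" ..
qed

text \<open>A norm factor \<open>R\<close> makes the support of \<open>R * Q\<close> even, so that
  \<open>half\<close> can be applied to both sides of \<open>R * Q * F = R * P\<close>.\<close>

lemma lrational_half:
  assumes "lrational v F"
  shows "lrational v (half F)"
proof -
  obtain P Q where PQ: "P \<in> lpolys v" "Q \<in> lpolys v" "Q $ 0 = 1" "Q * F = P"
    using assms unfolding lrational_def by blast
  obtain R where R: "R \<in> lpolys v" "R $ 0 = 1"
    "\<And>i. i < Suc v \<Longrightarrow> weigh (sign_char i) (R * Q) = R * Q"
    using ex_sign_invariant_multiple[OF PQ(2,3), of "Suc v"] by blast
  have RQ: "R * Q \<in> lpolys v" by (intro lpolys_times R PQ)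
  have "half (R * Q) * half F = half (R * Q * F)"
    using even_supp_if_sign_invariant[OF RQ] R(3) by (intro half_times[symmetric]) simp
  also have "\<dots> = half (R * P)" by (simp add: PQ(4)[symmetric] mult_ac)
  finally have "half (R * Q) * half F = half (R * P)" .
  moreover have "half (R * Q) $ 0 = 1"
    by (rule poly_mapping_eqI)
      (use R(2) PQ(3) injD[OF inj_double, of _ 0] in \<open>auto simp: lookup_one when_def\<close>)
  ultimately show ?thesis
    unfolding lrational_def using half_lpolys[OF RQ] half_lpolys[OF lpolys_times[OF R(1) PQ(1)]]
    by blast
qed

lemma lrational_funpow_half: "lrational v F \<Longrightarrow> lrational v ((half ^^ s) F)"
  by (induction s) (auto intro: lrational_half)

lemma ct_funpow_half: "ct ((half ^^ s) F) $ N = ct F $ (2 ^ s * N)"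
  by (induction s arbitrary: N) (simp_all add: mult_ac)

subsection \<open>Rational series as diagonals\<close>

lemma ex_common_denominator:
  assumes "finite A"
  shows "\<exists>M::int. M > 0 \<and> (\<forall>x\<in>A. \<exists>k. of_int M * x = (of_int k :: rat))"
  using assms
proof (induction A)
  case empty
  show ?case by (intro exI[of _ 1]) auto
next
  case (insert x A)
  then obtain M where M: "M > 0" "\<And>x. x \<in> A \<Longrightarrow> \<exists>k. of_int M * x = (of_int k :: rat)" by blast
  obtain a b where ab: "quotient_of x = (a, b)" by (cases "quotient_of x")
  have b: "b > 0" using quotient_of_denom_pos[OF ab] .
  have "of_int (M * b) * x = of_int (M * a)"
    using quotient_of_div[OF ab] b by simp
  then have "\<exists>k. of_int (M * b) * x = (of_int k :: rat)" by blast
  moreover have "\<exists>k. of_int (M * b) * y = (of_int k :: rat)" if y: "y \<in> A" for y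
  proof -
    obtain k where "of_int M * y = (of_int k :: rat)" using M(2)[OF y] by blast
    then have "of_int (M * b) * y = of_int (k * b)" by (simp add: mult_ac)
    then show ?thesis by blast
  qed
  ultimately have "\<forall>y\<in>insert x A. \<exists>k. of_int (M * b) * y = (of_int k :: rat)" by blast
  moreover have "M * b > 0" using M(1) b by simp
  ultimately show ?case by blast
qed

text \<open>
  A monomial \<open>X\<^sup>N x\<^sup>\<alpha>\<close> with \<open>\<alpha> \<in> box v N\<close> corresponds to the exponent vector
  \<open>(N, \<alpha>\<^sub>0 + N, \<dots>, \<alpha>\<^bsub>v - 1\<^esub> + N)\<close>, so that the constant term in \<open>x\<close> becomes the diagonal.
\<close>

definition to_expo :: "nat \<Rightarrow> (nat \<Rightarrow>\<^sub>0 nat) \<Rightarrow> expo" where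
  "to_expo v e = (\<Sum>i<v. single i (int (lookup e (Suc i)) - int (lookup e 0)))"

definition of_expo :: "nat \<Rightarrow> nat \<Rightarrow> expo \<Rightarrow> nat \<Rightarrow>\<^sub>0 nat" where
  "of_expo v N \<alpha> = single 0 N + (\<Sum>i<v. single (Suc i) (nat (lookup \<alpha> i + int N)))"

lemma lookup_to_expo:
  "lookup (to_expo v e) i = (if i < v then int (lookup e (Suc i)) - int (lookup e 0) else 0)"
  by (simp add: to_expo_def lookup_sum lookup_single when_def)

lemma lookup_of_expo_0 [simp]: "lookup (of_expo v N \<alpha>) 0 = N"
  by (simp add: of_expo_def lookup_sum lookup_add lookup_single when_def)

lemma lookup_of_expo_Suc:
  "lookup (of_expo v N \<alpha>) (Suc i) = (if i < v then nat (lookup \<alpha> i + int N) else 0)"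
  by (simp add: of_expo_def lookup_sum lookup_add lookup_single when_def)

lemma monomials_iff: "e \<in> monomials p \<longleftrightarrow> (\<forall>i\<ge>p. lookup e i = 0)"
  unfolding monomials_def subset_iff in_keys_iff lessThan_iff mem_Collect_eq by (meson not_le)

lemma box_iff: "\<alpha> \<in> box v N \<longleftrightarrow> (\<forall>i\<ge>v. lookup \<alpha> i = 0) \<and> (\<forall>i. - int N \<le> lookup \<alpha> i)"
  unfolding box_def subset_iff in_keys_iff lessThan_iff mem_Collect_eq by (meson not_le)

lemma to_expo_add: "to_expo v (d + e) = to_expo v d + to_expo v e"
  by (rule poly_mapping_eqI) (simp add: lookup_to_expo lookup_add)

lemma to_expo_box: "to_expo v e \<in> box v (lookup e 0)"
  by (auto simp: box_iff lookup_to_expo)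

lemma of_expo_monomials: "of_expo v N \<alpha> \<in> monomials (Suc v)"
  unfolding monomials_iff
proof (intro allI impI)
  fix i assume "Suc v \<le> i"
  then show "lookup (of_expo v N \<alpha>) i = 0" by (cases i) (auto simp: lookup_of_expo_Suc)
qed

lemma to_expo_of_expo: "\<alpha> \<in> box v N \<Longrightarrow> to_expo v (of_expo v N \<alpha>) = \<alpha>"
proof (rule poly_mapping_eqI)
  fix i assume "\<alpha> \<in> box v N"
  then have "- int N \<le> lookup \<alpha> i" "v \<le> i \<Longrightarrow> lookup \<alpha> i = 0" by (auto simp: box_iff)
  then show "lookup (to_expo v (of_expo v N \<alpha>)) i = lookup \<alpha> i"
    by (auto simp: lookup_to_expo lookup_of_expo_Suc)
qed

lemma monomials_eqI:
  assumes "e \<in> monomials (Suc v)" "e' \<in> monomials (Suc v)"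
    and "lookup e 0 = lookup e' 0" "to_expo v e = to_expo v e'"
  shows "e = e'"
proof (rule poly_mapping_eqI)
  fix i
  show "lookup e i = lookup e' i"
  proof (cases i)
    case (Suc j)
    have "lookup (to_expo v e) j = lookup (to_expo v e') j" by (simp only: assms)
    then show ?thesis
      using assms(1-3) Suc by (cases "j < v") (auto simp: lookup_to_expo monomials_iff)
  qed (simp add: assms)
qed

lemma of_expo_to_expo:
  "e \<in> monomials (Suc v) \<Longrightarrow> of_expo v (lookup e 0) (to_expo v e) = e"
  by (rule monomials_eqI[OF of_expo_monomials])
    (simp_all only: lookup_of_expo_0 to_expo_of_expo[OF to_expo_box])

lemma monomials_add_iff: "d + e \<in> monomials p \<longleftrightarrow> d \<in> monomials p \<and> e \<in> monomials p"
  by (auto simp: monomials_iff lookup_add)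

text \<open>The substitution sending \<open>X\<close> to the product of all v + 1 variables and the
  Laurent variable i to the variable i + 1. It is faithful only on \<open>supported (box v)\<close>;
  terms outside are never read.\<close>

definition mfps_of_laurent :: "nat \<Rightarrow> laurent fps \<Rightarrow> rat mfps" where
  "mfps_of_laurent v F e =
     (if e \<in> monomials (Suc v) then lookup (F $ lookup e 0) (to_expo v e) else 0)"

lemma mfps_times_of_laurent:
  assumes Q: "Q \<in> supported (box v)" and F: "F \<in> supported (box v)"
  shows "mfps_times (mfps_of_laurent v Q) (mfps_of_laurent v F) = mfps_of_laurent v (Q * F)"
proof
  fix e :: "nat \<Rightarrow>\<^sub>0 nat"
  let ?q = "mfps_of_laurent v Q" and ?f = "mfps_of_laurent v F"
  let ?D = "{(d, d'). d + d' = e}"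
  show "mfps_times ?q ?f e = mfps_of_laurent v (Q * F) e"
  proof (cases "e \<in> monomials (Suc v)")
    case False
    then have "mfps_times ?q ?f e = 0"
      unfolding mfps_times_def
      by (intro sum.neutral) (auto simp: mfps_of_laurent_def monomials_add_iff)
    with False show ?thesis by (simp add: mfps_of_laurent_def)
  next
    case True
    define N where "N = lookup e 0"
    define \<alpha> where "\<alpha> = to_expo v e"
    let ?Z = "Sigma {..N} (\<lambda>i. keys (Q $ i))"
    let ?t = "\<lambda>(i, \<beta>). lookup (Q $ i) \<beta> * lookup (F $ (N - i)) (\<alpha> - \<beta>)"
    have "mfps_times ?q ?f e = (\<Sum>(d, d')\<in>?D. ?q d * ?f d')"
      by (simp add: mfps_times_def)
    also have "\<dots> = sum ?t ?Z"
    \<comment> \<open>The index sets match only up to vanishing terms: on one side the pairs where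
      \<open>Q\<close> has coefficient 0, on the other those where \<alpha> - \<beta> leaves the box
      and \<open>F\<close> has coefficient 0.\<close>
    proof (rule sum.reindex_bij_witness_not_neutral[where
          S' = "{(d, d')\<in>?D. ?q d = 0}" and T' = "{(i, \<beta>)\<in>?Z. \<alpha> - \<beta> \<notin> box v (N - i)}"
          and j = "\<lambda>(d, d'). (lookup d 0, to_expo v d)"
          and i = "\<lambda>(i, \<beta>). (of_expo v i \<beta>, of_expo v (N - i) (\<alpha> - \<beta>))"])
      show "finite {(d, d')\<in>?D. ?q d = 0}"
        by (rule finite_subset[OF _ finite_exponent_decompositions[of e]]) auto
      show "finite {(i, \<beta>)\<in>?Z. \<alpha> - \<beta> \<notin> box v (N - i)}"
        by (rule finite_subset[of _ ?Z]) auto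
    next
      fix a assume a: "a \<in> ?D - {(d, d')\<in>?D. ?q d = 0}"
      then obtain d d' where d: "a = (d, d')" "d + d' = e" "?q d \<noteq> 0" by auto
      then have m: "d \<in> monomials (Suc v)" "d' \<in> monomials (Suc v)"
        using True monomials_add_iff[of d d'] by auto
      have N: "N - lookup d 0 = lookup d' 0" "lookup d 0 \<le> N" and \<alpha>: "\<alpha> - to_expo v d = to_expo v d'"
        by (simp_all add: N_def \<alpha>_def d(2)[symmetric] lookup_add to_expo_add)
      show "(case case a of (d, d') \<Rightarrow> (lookup d 0, to_expo v d) of
          (i, \<beta>) \<Rightarrow> (of_expo v i \<beta>, of_expo v (N - i) (\<alpha> - \<beta>))) = a"
        using m by (simp add: d(1) N \<alpha> of_expo_to_expo)
      show "(case a of (d, d') \<Rightarrow> (lookup d 0, to_expo v d))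
          \<in> ?Z - {(i, \<beta>)\<in>?Z. \<alpha> - \<beta> \<notin> box v (N - i)}"
        using m d(3) N \<alpha> to_expo_box[of v d'] by (auto simp: d(1) mfps_of_laurent_def in_keys_iff)
    next
      fix b assume "b \<in> ?Z - {(i, \<beta>)\<in>?Z. \<alpha> - \<beta> \<notin> box v (N - i)}"
      then obtain i \<beta> where b: "b = (i, \<beta>)" "i \<le> N" "\<beta> \<in> keys (Q $ i)" "\<alpha> - \<beta> \<in> box v (N - i)"
        by auto
      have \<beta>: "\<beta> \<in> box v i" using b(3) Q by (auto simp: supported_def)
      show "(case case b of (i, \<beta>) \<Rightarrow> (of_expo v i \<beta>, of_expo v (N - i) (\<alpha> - \<beta>)) of
          (d, d') \<Rightarrow> (lookup d 0, to_expo v d)) = b"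
        by (simp add: b(1) to_expo_of_expo \<beta>)
      have "of_expo v i \<beta> + of_expo v (N - i) (\<alpha> - \<beta>) = e"
      proof (rule monomials_eqI[OF _ True])
        show "of_expo v i \<beta> + of_expo v (N - i) (\<alpha> - \<beta>) \<in> monomials (Suc v)"
          by (simp add: monomials_add_iff of_expo_monomials)
        show "lookup (of_expo v i \<beta> + of_expo v (N - i) (\<alpha> - \<beta>)) 0 = lookup e 0"
          using b(2) by (simp add: lookup_add N_def)
        show "to_expo v (of_expo v i \<beta> + of_expo v (N - i) (\<alpha> - \<beta>)) = to_expo v e"
          by (simp add: to_expo_add to_expo_of_expo \<beta> b(4)) (simp add: \<alpha>_def)
      qed
      moreover have "?q (of_expo v i \<beta>) \<noteq> 0"
        using b(3) by (simp add: mfps_of_laurent_def of_expo_monomials to_expo_of_expo \<beta> in_keys_iff)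
      ultimately show "(case b of (i, \<beta>) \<Rightarrow> (of_expo v i \<beta>, of_expo v (N - i) (\<alpha> - \<beta>)))
          \<in> ?D - {(d, d')\<in>?D. ?q d = 0}"
        by (simp add: b(1))
    next
      fix a assume "a \<in> {(d, d')\<in>?D. ?q d = 0}"
      then show "(case a of (d, d') \<Rightarrow> ?q d * ?f d') = 0" by auto
    next
      fix b assume "b \<in> {(i, \<beta>)\<in>?Z. \<alpha> - \<beta> \<notin> box v (N - i)}"
      then obtain i \<beta> where b: "b = (i, \<beta>)" "\<alpha> - \<beta> \<notin> box v (N - i)" by auto
      have "\<alpha> - \<beta> \<notin> keys (F $ (N - i))" using b(2) F by (auto simp: supported_def)
      then show "?t b = 0" by (simp add: b(1) in_keys_iff)
    next
      fix a assume "a \<in> ?D"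
      then obtain d d' where d: "a = (d, d')" "d + d' = e" by auto
      then have m: "d \<in> monomials (Suc v)" "d' \<in> monomials (Suc v)"
        using True monomials_add_iff[of d d'] by auto
      have N: "N - lookup d 0 = lookup d' 0" and \<alpha>: "\<alpha> - to_expo v d = to_expo v d'"
        by (simp_all add: N_def \<alpha>_def d(2)[symmetric] lookup_add to_expo_add)
      show "?t (case a of (d, d') \<Rightarrow> (lookup d 0, to_expo v d)) = (case a of (d, d') \<Rightarrow> ?q d * ?f d')"
        using m N \<alpha> by (simp add: d(1) mfps_of_laurent_def)
    qed
    also have "\<dots> = lookup ((Q * F) $ N) \<alpha>"
      by (simp add: coeff_times_superset[where B = "\<lambda>i. keys (Q $ i)"] sum.Sigma)
    also have "\<dots> = mfps_of_laurent v (Q * F) e"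
      using True by (simp add: mfps_of_laurent_def N_def \<alpha>_def)
    finally show ?thesis .
  qed
qed

lemma finite_support_mfps_of_laurent:
  assumes "P \<in> lpolys v"
  shows "finite {e. mfps_of_laurent v P e \<noteq> 0}"
proof -
  obtain D where D: "\<And>N. N > D \<Longrightarrow> P $ N = 0" using assms by (auto simp: lpolys_def)
  let ?h = "\<lambda>e. (lookup e 0, to_expo v e)"
  have "?h ` {e. mfps_of_laurent v P e \<noteq> 0} \<subseteq> Sigma {..D} (\<lambda>N. keys (P $ N))"
  proof (rule image_subsetI)
    fix e assume "e \<in> {e. mfps_of_laurent v P e \<noteq> 0}"
    then have "lookup (P $ lookup e 0) (to_expo v e) \<noteq> 0"
      by (auto simp: mfps_of_laurent_def split: if_splits)
    then show "?h e \<in> Sigma {..D} (\<lambda>N. keys (P $ N))"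
      using D[of "lookup e 0"] by (cases "lookup e 0 > D") (auto simp: in_keys_iff)
  qed
  then have "finite (?h ` {e. mfps_of_laurent v P e \<noteq> 0})"
    by (rule finite_subset) auto
  then show ?thesis
    by (rule finite_imageD)
      (auto simp: inj_on_def mfps_of_laurent_def intro: monomials_eqI split: if_splits)
qed

lemma ex_mpoly_of_laurent:
  assumes P: "P \<in> lpolys v"
    and int: "\<And>e. \<exists>k. of_int M * mfps_of_laurent v P e = of_int k"
  shows "\<exists>P'\<in>mpolys (Suc v). mfps_of_mpoly P' = mfps_of_laurent v (scalar (of_int M) * P)"
proof -
  obtain k where k: "\<And>e. of_int M * mfps_of_laurent v P e = of_int (k e)" using int by metis
  have k0: "k e = 0" if "mfps_of_laurent v P e = 0" for e using k[of e] that by simp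
  have fin: "finite {e. k e \<noteq> 0}"
    by (rule finite_subset[OF _ finite_support_mfps_of_laurent[OF P]]) (auto dest: k0)
  have lookup: "lookup (Poly_Mapping.Abs_poly_mapping k) = k"
    using fin by simp
  show ?thesis
  proof (rule bexI[of _ "Poly_Mapping.Abs_poly_mapping k"])
    have "mfps_of_laurent v (scalar (of_int M) * P) e = of_int (k e)" for e
      unfolding k[symmetric] using lookup_times_scalar[of P "of_int M"]
      by (simp add: mfps_of_laurent_def mult.commute)
    then show "mfps_of_mpoly (Poly_Mapping.Abs_poly_mapping k)
        = mfps_of_laurent v (scalar (of_int M) * P)"
      by (auto simp: mfps_of_mpoly_def lookup)
    show "Poly_Mapping.Abs_poly_mapping k \<in> mpolys (Suc v)"
      unfolding mpolys_def mem_Collect_eq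
    proof
      fix e assume "e \<in> keys (Poly_Mapping.Abs_poly_mapping k)"
      then have "mfps_of_laurent v P e \<noteq> 0" using k0[of e] by (auto simp: in_keys_iff lookup)
      then show "e \<in> monomials (Suc v)" by (auto simp: mfps_of_laurent_def split: if_splits)
    qed
  qed
qed

theorem ct_lrational_diagonal:
  assumes "lrational v F"
  shows "\<exists>r. rational_mfps (Suc v) r \<and> ct F = diagonal (Suc v) r"
proof -
  obtain P Q where PQ: "P \<in> lpolys v" "Q \<in> lpolys v" "Q $ 0 = 1" "Q * F = P"
    using assms unfolding lrational_def by blast
  then have s: "P \<in> supported (box v)" "Q \<in> supported (box v)" by (auto simp: lpolys_def)
  have F: "F \<in> supported (box v)"
    using supported_quotient[OF graded_box s PQ(3,4)] .
  let ?A = "range (mfps_of_laurent v P) \<union> range (mfps_of_laurent v Q)"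
  have "finite (range (mfps_of_laurent v R))" if "R \<in> lpolys v" for R
  proof (rule finite_subset)
    show "range (mfps_of_laurent v R)
        \<subseteq> insert 0 (mfps_of_laurent v R ` {e. mfps_of_laurent v R e \<noteq> 0})" by auto
    show "finite (insert 0 (mfps_of_laurent v R ` {e. mfps_of_laurent v R e \<noteq> 0}))"
      using finite_support_mfps_of_laurent[OF that] by simp
  qed
  with PQ(1,2) have "finite ?A" by simp
  \<comment> \<open>\<open>rational_mfps\<close> asks for integer polynomials, so the finitely many
    coefficients of \<open>P\<close> and \<open>Q\<close> are cleared of denominators by one
    integer.\<close>
  then obtain M where M: "M > 0" "\<And>x. x \<in> ?A \<Longrightarrow> \<exists>k. of_int M * x = (of_int k :: rat)"
    using ex_common_denominator by metis
  obtain P' where P': "P' \<in> mpolys (Suc v)"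
    "mfps_of_mpoly P' = mfps_of_laurent v (scalar (of_int M) * P)"
    using ex_mpoly_of_laurent[OF PQ(1), of M] M(2) by blast
  obtain Q' where Q': "Q' \<in> mpolys (Suc v)"
    "mfps_of_mpoly Q' = mfps_of_laurent v (scalar (of_int M) * Q)"
    using ex_mpoly_of_laurent[OF PQ(2), of M] M(2) by blast
  let ?r = "mfps_of_laurent v F"
  have "scalar (of_int M) \<in> supported (box v)"
    by (auto simp: scalar_def supported_def box_def simp del: single_of_int)
  then have "mfps_times (mfps_of_mpoly Q') ?r = mfps_of_mpoly P'"
    using s(2) F PQ(4) by (simp add: P'(2) Q'(2) mfps_times_of_laurent supported_times[OF graded_box] mult.assoc)
  moreover have "Q' \<noteq> 0"
  proof
    assume "Q' = 0"
    then have "mfps_of_laurent v (scalar (of_int M) * Q) 0 = 0"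
      by (simp add: Q'(2)[symmetric] mfps_of_mpoly_def)
    moreover have "mfps_of_laurent v (scalar (of_int M) * Q) 0 = of_int M"
      using PQ(3) lookup_times_scalar[of Q "of_int M" 0 0]
      by (simp add: mfps_of_laurent_def monomials_def to_expo_def mult.commute)
    ultimately show False using M(1) by simp
  qed
  moreover have "?r \<in> mfpss (Suc v)"
    by (auto simp: mfpss_def mfps_of_laurent_def)
  ultimately have "rational_mfps (Suc v) ?r"
    using P'(1) Q'(1) unfolding rational_mfps_def by blast
  moreover have "ct F = diagonal (Suc v) ?r"
  proof (rule fps_ext)
    fix N
    let ?d = "\<Sum>i<Suc v. single i N :: nat \<Rightarrow>\<^sub>0 nat"
    have l: "lookup ?d i = (if i < Suc v then N else 0)" for i
      by (simp add: lookup_sum lookup_single when_def del: sum.lessThan_Suc)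
    have "to_expo v ?d = 0"
      by (rule poly_mapping_eqI) (simp add: lookup_to_expo l del: sum.lessThan_Suc)
    then show "ct F $ N = diagonal (Suc v) ?r $ N"
      by (simp add: diagonal_def mfps_of_laurent_def monomials_iff l del: sum.lessThan_Suc)
  qed
  ultimately show ?thesis by blast
qed

lemma ct_add: "ct (F + G) = ct F + ct G"
  by (rule fps_ext) (simp add: lookup_add)

lemma ct_sum: "ct (sum F I) = (\<Sum>i\<in>I. ct (F i))"
  by (rule fps_ext) (simp add: fps_sum_nth lookup_sum)

lemma ct_X_times: "ct (fps_X * F) = fps_X * ct F"
  by (rule fps_ext) simp

lemma supported_times_monom:
  assumes "\<And>N \<alpha>. \<alpha> \<in> keys (F $ N) \<Longrightarrow> \<alpha> + \<beta> \<in> C N"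
  shows "F * monom_fps \<beta> \<in> supported C"
  unfolding supported_def
proof (intro CollectI allI subsetI)
  fix N \<alpha> assume "\<alpha> \<in> keys ((F * monom_fps \<beta>) $ N)"
  then have "\<alpha> - \<beta> \<in> keys (F $ N)" by (simp add: in_keys_iff lookup_times_monom_fps)
  then show "\<alpha> \<in> C N" using assms by fastforce
qed

lemma lpolys_times_monom:
  assumes F: "F \<in> lpolys v" and "F * monom_fps \<beta> \<in> supported (box v)"
  shows "F * monom_fps \<beta> \<in> lpolys v"
proof -
  obtain D where D: "\<And>N. N > D \<Longrightarrow> F $ N = 0" using F unfolding lpolys_def by blast
  then have "(F * monom_fps \<beta>) $ N = 0" if "N > D" for N
    using that by (simp add: monom_fps_def)
  then show ?thesis using assms(2) by (auto simp: lpolys_def)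
qed

lemma keys_theta:
  assumes "\<alpha> \<in> keys (theta j F $ N)"
  shows "\<alpha> \<in> keys (F $ N)" "lookup \<alpha> j \<noteq> 0"
  using assms by (auto simp: theta_def in_keys_iff)

subsection \<open>Multivariate Lagrange inversion\<close>

abbreviation unknown :: "nat \<Rightarrow> laurent fps" where
  "unknown i \<equiv> monom_fps (single i 1)"

abbreviation unknown_inv :: "nat \<Rightarrow> laurent fps" where
  "unknown_inv i \<equiv> monom_fps (single i (- 1))"

text \<open>Genuine power series in the unknowns; the exponents of the remaining variables are
  unrestricted.\<close>

definition nonneg :: "nat \<Rightarrow> nat \<Rightarrow> nat \<Rightarrow> expo set" where
  "nonneg n d N = {\<alpha>. \<forall>i<d. 0 \<le> lookup \<alpha> (n + i)}"

text \<open>\<open>theta (n + j) (e i) * unknown_inv (n + j)\<close> is the ordinary partial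
  derivative of \<open>e i\<close> by the unknown j, so this is det(I - de/dy).\<close>

definition jacobian :: "nat \<Rightarrow> nat \<Rightarrow> (nat \<Rightarrow> laurent fps) \<Rightarrow> laurent fps" where
  "jacobian n d e = alt d (\<lambda>i j. (if i = j then 1 else 0) - theta (n + j) (e i) * unknown_inv (n + j))"

lemma unknown_unknown_inv: "unknown i * unknown_inv i = 1"
  by (simp add: monom_fps_add[symmetric] single_add[symmetric])

lemma graded_nonneg: "graded (nonneg n d)"
  by (simp add: graded_def nonneg_def lookup_add)

lemma coefficient_part_nonneg: "coefficient_part n \<subseteq> supported (nonneg n d)"
proof (rule supported_mono, rule subsetI)
  fix N \<alpha> assume *: "\<alpha> \<in> {\<alpha> :: expo. keys \<alpha> \<subseteq> {..<n}}"
  have "lookup \<alpha> (n + i) = 0" for i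
  proof -
    have "n + i \<notin> keys \<alpha>" using * by auto
    then show ?thesis by (simp add: in_keys_iff)
  qed
  then show "\<alpha> \<in> nonneg n d N" by (simp add: nonneg_def)
qed

lemma unknown_supported_nonneg: "unknown i \<in> supported (nonneg n d)"
  by (auto simp: supported_def nonneg_def monom_fps_def lookup_single when_def)

text \<open>
  Multiplication by \<open>jacobian / \<Prod>(1 - e\<^sub>i / y\<^sub>i)\<close> followed by taking constant terms annihilates the
  ideal generated by the \<open>y\<^sub>i - e\<^sub>i\<close>, hence evaluates a series in the unknowns at the solution.
\<close>

lemma lagrange_good:
  fixes e Y H :: "nat \<Rightarrow> laurent fps" and U :: "nat \<Rightarrow> nat \<Rightarrow> laurent fps"
  assumes e: "\<And>i. i < d \<Longrightarrow> e i \<in> supported (nonneg n d)" "\<And>i. i < d \<Longrightarrow> e i $ 0 = 0"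
    and Y: "\<And>i. i < d \<Longrightarrow> Y i \<in> coefficient_part n"
    and U: "\<And>i j. i < d \<Longrightarrow> j < d \<Longrightarrow> U i j \<in> supported (nonneg n d)"
    and eY: "\<And>i. i < d \<Longrightarrow> e i - Y i = fps_X * (\<Sum>j<d. U i j * (unknown (n + j) - Y j))"
    and H: "\<And>i. i < d \<Longrightarrow> H i * (1 - e i * unknown_inv (n + i)) = 1"
    and c: "c \<in> coefficient_part n" and k: "k < d"
  shows "ct ((c + unknown (n + k)) * (jacobian n d e * (\<Prod>i<d. H i))) = ct (c + Y k)"
proof -
  define D where "D = jacobian n d e * (\<Prod>i<d. H i)"
  define f where "f i = e i * unknown_inv (n + i)" for i
  have f0: "f i $ 0 = 0" if "i < d" for i using e(2)[OF that] by (simp add: f_def)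
  have H': "H i * (1 - f i) = 1" if "i < d" for i using H[OF that] by (simp add: f_def)
  obtain g where g: "\<And>i j. i < d \<Longrightarrow> theta j (g i) = theta j (f i) * H i"
    using ex_log[OF f0 H'] by metis
  \<comment> \<open>\<open>- g i\<close> plays the role of log(1 - f_i). Scaling row i by H_i / y_i
    and column j by y_j turns I - de/dy into the matrix of the logarithmic derivatives theta_j
    log(y_i - e_i).\<close>
  have row: "(unknown_inv (n + i) * H i) *
      (((if i = j then 1 else 0) - theta (n + j) (e i) * unknown_inv (n + j)) * unknown (n + j))
      = log_row n i 1 (- g i) j" if "i < d" for i j
  proof -
    have "theta (n + j) (f i)
        = theta (n + j) (e i) * unknown_inv (n + i) - (if i = j then f i else 0)"
      by (simp add: f_def theta_times theta_monom_fps lookup_single when_def scalar_uminus)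
    then have th: "theta (n + j) (e i) * unknown_inv (n + i)
        = theta (n + j) (f i) + (if i = j then f i else 0)" by simp
    have "((if i = j then 1 else 0) - theta (n + j) (e i) * unknown_inv (n + j)) * unknown (n + j)
        = (if i = j then unknown (n + j) else 0)
          - theta (n + j) (e i) * (unknown (n + j) * unknown_inv (n + j))"
      by (simp add: algebra_simps)
    then have "(unknown_inv (n + i) * H i) *
        (((if i = j then 1 else 0) - theta (n + j) (e i) * unknown_inv (n + j)) * unknown (n + j))
      = H i * ((if i = j then unknown (n + i) * unknown_inv (n + i) else 0)
          - theta (n + j) (e i) * unknown_inv (n + i))"
      by (simp add: unknown_unknown_inv algebra_simps)
    also have "\<dots> = H i * ((if i = j then 1 - f i else 0) - theta (n + j) (f i))"
      by (simp add: unknown_unknown_inv th)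
    also have "\<dots> = (if i = j then H i * (1 - f i) else 0) - theta (n + j) (f i) * H i"
      by (simp add: right_diff_distrib mult.commute)
    also have "\<dots> = log_row n i 1 (- g i) j"
      using H'[OF that] g[OF that, of "n + j"]
      by (cases "i = j") (simp_all add: log_row_def theta_uminus)
    finally show ?thesis .
  qed
  have "alt d (\<lambda>i. log_row n i 1 (- g i))
      = (\<Prod>i<d. unknown_inv (n + i) * H i) * (jacobian n d e * (\<Prod>i<d. unknown (n + i)))"
    unfolding jacobian_def alt_scale_columns[symmetric] alt_scale[symmetric]
    by (rule alt_cong) (simp only: row)
  also have "\<dots> = D * (\<Prod>i<d. unknown (n + i) * unknown_inv (n + i))"
    by (simp only: D_def prod.distrib mult_ac)
  finally have D: "D = alt d (\<lambda>i. log_row n i 1 (- g i))"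
    by (simp add: unknown_unknown_inv)
  have ct_D: "ct (b * D) = ct b" if "b \<in> coefficient_part n" for b
    unfolding D by (rule ct_alt_log_row[OF that])
  \<comment> \<open>The factor y_i - e_i = y_i (1 - f_i) cancels \<open>H i\<close>, the only factor
    with negative powers of y_i. What remains is y_i times a series without such powers, hence has
    no constant term.\<close>
  have ideal: "ct (h * (unknown (n + i) - e i) * D) = 0"
    if h: "h \<in> supported (nonneg n d)" and i: "i < d" for h i
  proof -
    let ?P = "\<lambda>_. {\<alpha>. 0 \<le> lookup \<alpha> (n + i)} :: expo set"
    have P: "graded ?P" by (simp add: graded_def lookup_add)
    have sub: "F \<in> supported ?P" if "F \<in> supported (nonneg n d)" for F
      using that supported_mono[of "nonneg n d" ?P] i by (auto simp: nonneg_def)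
    have inv: "unknown_inv (n + j) \<in> supported ?P" if "j \<noteq> i" for j
      using that by (auto simp: supported_def monom_fps_def lookup_single when_def)
    \<comment> \<open>\<open>theta\<close> kills the terms free of the unknown j, so dividing by it
      creates no negative exponent.\<close>
    have entry: "theta (n + j) (e l) * unknown_inv (n + j) \<in> supported (nonneg n d)"
      if l: "l < d" for l j
    proof (rule supported_times_monom)
      fix N \<alpha> assume \<alpha>: "\<alpha> \<in> keys (theta (n + j) (e l) $ N)"
      have "\<alpha> \<in> nonneg n d N" using keys_theta(1)[OF \<alpha>] e(1)[OF l] by (auto simp: supported_def)
      then show "\<alpha> + single (n + j) (- 1) \<in> nonneg n d N"
        using keys_theta(2)[OF \<alpha>] by (auto simp: nonneg_def lookup_add lookup_single when_def)
    qed
    have "jacobian n d e \<in> supported (nonneg n d)"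
      unfolding jacobian_def alt_def
    proof (intro supported_sum supported_times[OF graded_nonneg] supported_prod[OF graded_nonneg])
      fix p show "of_int (sign p) \<in> supported (nonneg n d)"
        by (auto simp: sign_def intro: supported_1[OF graded_nonneg] supported_uminus)
    next
      fix p l assume "l \<in> {..<d}"
      then show "(if l = p l then 1 else 0) - theta (n + p l) (e l) * unknown_inv (n + p l)
          \<in> supported (nonneg n d)"
        by (intro supported_minus entry) (auto intro: supported_1[OF graded_nonneg])
    qed
    then have J: "jacobian n d e \<in> supported ?P" by (rule sub)
    have Hj: "H j \<in> supported ?P" if "j < d" "j \<noteq> i" for j
    proof (rule supported_inverse[OF P _ f0 H'])
      show "f j \<in> supported ?P"
        unfolding f_def using that by (intro supported_times[OF P] sub[OF e(1)] inv) auto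
    qed (use that in auto)
    let ?G = "h * jacobian n d e * (\<Prod>j\<in>{..<d} - {i}. H j)"
    have G: "?G \<in> supported ?P"
      using Hj by (intro supported_times[OF P] supported_prod[OF P] J sub[OF h]) auto
    have "unknown (n + i) - e i = unknown (n + i) * (1 - f i)"
      using unknown_unknown_inv[of "n + i"] by (simp add: f_def algebra_simps)
    moreover have "(\<Prod>j<d. H j) = H i * (\<Prod>j\<in>{..<d} - {i}. H j)"
      using i by (intro prod.remove) auto
    ultimately have "h * (unknown (n + i) - e i) * D = ?G * unknown (n + i) * (H i * (1 - f i))"
      by (simp only: D_def mult_ac)
    then have eq: "h * (unknown (n + i) - e i) * D = ?G * unknown (n + i)"
      by (simp add: H'[OF i])
    have "lookup (?G $ N) (0 - single (n + i) 1) = 0" for N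
    proof -
      have "0 - single (n + i) 1 \<notin> keys (?G $ N)"
      proof
        assume "0 - single (n + i) 1 \<in> keys (?G $ N)"
        with G have "0 \<le> lookup (0 - single (n + i) 1 :: expo) (n + i)"
          unfolding supported_def by blast
        then show False by (simp only: lookup_minus lookup_zero lookup_single_eq)
      qed
      then show ?thesis by (simp only: in_keys_iff not_not)
    qed
    then show ?thesis
      unfolding eq by (intro fps_ext) (simp only: ct_nth lookup_times_monom_fps fps_zero_nth)
  qed
  \<comment> \<open>Modulo the multiples of y_i - e_i settled by \<open>ideal\<close>, the
    difference y_i - Y_i is \<open>fps_X\<close> times a combination of the y_j - Y_j; each round
    therefore gains one more vanishing coefficient.\<close>
  have vanish: "\<forall>h i. h \<in> supported (nonneg n d) \<longrightarrow> i < d \<longrightarrow>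
      (\<forall>N<K. ct (h * (unknown (n + i) - Y i) * D) $ N = 0)" for K
  proof (induction K)
    case (Suc K)
    show ?case
    proof (intro allI impI)
      fix h i N assume h: "h \<in> supported (nonneg n d)" and i: "i < d" and N: "N < Suc K"
      have eq: "unknown (n + i) - Y i
          = (unknown (n + i) - e i) + fps_X * (\<Sum>j<d. U i j * (unknown (n + j) - Y j))"
        by (simp only: eY[OF i, symmetric]) simp
      have "h * (unknown (n + i) - Y i) * D
          = h * ((unknown (n + i) - e i) + fps_X * (\<Sum>j<d. U i j * (unknown (n + j) - Y j))) * D"
        by (simp only: eq)
      also have "\<dots> = h * (unknown (n + i) - e i) * D
          + fps_X * (\<Sum>j<d. h * U i j * (unknown (n + j) - Y j) * D)"
        by (simp only: distrib_left distrib_right sum_distrib_left sum_distrib_right mult_ac)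
      finally have "h * (unknown (n + i) - Y i) * D = h * (unknown (n + i) - e i) * D
          + fps_X * (\<Sum>j<d. h * U i j * (unknown (n + j) - Y j) * D)" .
      then have "ct (h * (unknown (n + i) - Y i) * D)
          = fps_X * (\<Sum>j<d. ct (h * U i j * (unknown (n + j) - Y j) * D))"
        by (simp only: ct_add ct_X_times ct_sum ideal[OF h i] add_0_left)
      moreover have "ct (h * U i j * (unknown (n + j) - Y j) * D) $ M = 0" if "j < d" "M < K" for j M
        using Suc.IH that supported_times[OF graded_nonneg h U[OF i that(1)]] by blast
      ultimately show "ct (h * (unknown (n + i) - Y i) * D) $ N = 0"
        using N by (cases N) (simp_all add: fps_sum_nth)
    qed
  qed simp
  have "ct (1 * (unknown (n + k) - Y k) * D) $ N = 0" for N
    using vanish[of "Suc N", rule_format, OF supported_1[OF graded_nonneg] k, of N] by simp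
  then have "ct (1 * (unknown (n + k) - Y k) * D) = 0"
    by (intro fps_ext) (simp only: fps_zero_nth)
  moreover have "(c + unknown (n + k)) * D = (c + Y k) * D + 1 * (unknown (n + k) - Y k) * D"
    by (simp add: algebra_simps)
  ultimately have "ct ((c + unknown (n + k)) * D) = ct ((c + Y k) * D)"
    by (simp only: ct_add add_0_right)
  also have "\<dots> = ct (c + Y k)"
    by (intro ct_D supported_add c Y k)
  finally show ?thesis by (simp only: D_def)
qed

text \<open>Division by an unknown must not leave \<open>box\<close>. For e_i / y_i this holds
  because \<open>e i\<close> has no degree 0 part and an exponent -1 is allowed from degree 1 on; in
  the Jacobian, every term surviving \<open>theta (n + j)\<close> has a positive exponent to
  spare.\<close>

lemma lrational_lagrange:
  fixes e H :: "nat \<Rightarrow> laurent fps"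
  assumes e: "\<And>i. i < d \<Longrightarrow> e i \<in> supported (nonneg n d)" "\<And>i. i < d \<Longrightarrow> e i $ 0 = 0"
      "\<And>i. i < d \<Longrightarrow> e i \<in> lpolys (n + d)"
    and H: "\<And>i. i < d \<Longrightarrow> H i * (1 - e i * unknown_inv (n + i)) = 1"
    and c: "c \<in> lpolys (n + d)"
  shows "lrational (n + d) (c * (jacobian n d e * (\<Prod>i<d. H i)))"
  unfolding lrational_def
proof (intro bexI conjI)
  let ?Q = "\<Prod>i<d. 1 - e i * unknown_inv (n + i)"
  have "?Q * (\<Prod>i<d. H i) = (\<Prod>i<d. H i * (1 - e i * unknown_inv (n + i)))"
    by (simp only: prod.distrib mult.commute)
  also have "\<dots> = 1" using H by simp
  finally have Q: "?Q * (\<Prod>i<d. H i) = 1" .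
  show "?Q * (c * (jacobian n d e * (\<Prod>i<d. H i))) = c * jacobian n d e"
    using Q by (metis (no_types, lifting) mult.assoc mult.left_commute mult.right_neutral)
  have "?Q $ 0 = (\<Prod>i<d. (1 - e i * unknown_inv (n + i)) $ 0)"
    by (induction d) (simp_all add: fps_mult_nth_0)
  also have "\<dots> = 1" using e(2) by simp
  finally show "?Q $ 0 = 1" .
  have box: "\<alpha> \<in> box (n + d) N" "\<alpha> \<in> nonneg n d N" if "\<alpha> \<in> keys (e i $ N)" "i < d" for \<alpha> i N
    using that e(1,3)[OF that(2)] by (auto simp: lpolys_def supported_def)
  have shift: "\<alpha> + single (n + i) (- 1) \<in> box (n + d) N"
    if "\<alpha> \<in> box (n + d) N" "i < d" "lookup \<alpha> (n + i) \<ge> 1 - int N" for \<alpha> i N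
    using that by (auto simp: box_iff lookup_add lookup_single when_def)
  show "?Q \<in> lpolys (n + d)"
  proof (intro lpolys_prod lpolys_minus lpolys_1 lpolys_times_monom supported_times_monom shift)
    fix i N \<alpha> assume i: "i \<in> {..<d}" and \<alpha>: "\<alpha> \<in> keys (e i $ N)"
    have "N > 0" using e(2) i \<alpha> by (cases N) auto
    then show "lookup \<alpha> (n + i) \<ge> 1 - int N"
      using box(2)[OF \<alpha>] i by (auto simp: nonneg_def dest!: spec[of _ i])
    show "\<alpha> \<in> box (n + d) N" using box(1)[OF \<alpha>] i by simp
  qed (use e(3) in auto)
  show "c * jacobian n d e \<in> lpolys (n + d)"
    unfolding jacobian_def
  proof (intro lpolys_times[OF c] lpolys_alt lpolys_minus lpolys_times_monom supported_times_monom shift)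
    fix i j N \<alpha> assume i: "i < d" and j: "j < d" and \<alpha>: "\<alpha> \<in> keys (theta (n + j) (e i) $ N)"
    have "lookup \<alpha> (n + j) \<noteq> 0" "0 \<le> lookup \<alpha> (n + j)"
      using keys_theta[OF \<alpha>] box(2)[of \<alpha> i N] i j by (auto simp: nonneg_def)
    then show "lookup \<alpha> (n + j) \<ge> 1 - int N" by simp
    show "\<alpha> \<in> box (n + d) N" using keys_theta(1)[OF \<alpha>] i by (rule box(1))
  qed (use e(3) in \<open>auto simp: theta_def intro: lpolys_weigh\<close>)
qed

subsection \<open>Polynomial systems\<close>

text \<open>Polynomials are kept as functions because the same map is evaluated both at the unknowns
  and at the solution.\<close>

inductive polymap :: "'r set \<Rightarrow> 'i set \<Rightarrow> (('i \<Rightarrow> 'r) \<Rightarrow> 'r::comm_ring_1) \<Rightarrow> bool" for K I where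
  const: "c \<in> K \<Longrightarrow> polymap K I (\<lambda>_. c)"
| proj: "i \<in> I \<Longrightarrow> polymap K I (\<lambda>y. y i)"
| add: "polymap K I \<phi> \<Longrightarrow> polymap K I \<psi> \<Longrightarrow> polymap K I (\<lambda>y. \<phi> y + \<psi> y)"
| mult: "polymap K I \<phi> \<Longrightarrow> polymap K I \<psi> \<Longrightarrow> polymap K I (\<lambda>y. \<phi> y * \<psi> y)"

lemma polymap_sum:
  assumes "0 \<in> K" "\<And>a. a \<in> A \<Longrightarrow> polymap K I (\<phi> a)"
  shows "polymap K I (\<lambda>y. \<Sum>a\<in>A. \<phi> a y)"
  using assms(2)
  by (induction A rule: infinite_finite_induct) (auto intro: polymap.intros assms(1))

lemma polymap_supported:
  assumes "polymap K I \<phi>" and C: "graded C" and "K \<subseteq> supported C"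
    and "\<And>i. i \<in> I \<Longrightarrow> y i \<in> supported C"
  shows "\<phi> y \<in> supported C"
  using assms(1)
  by induction (use assms in \<open>auto intro: supported_add supported_times[OF C]\<close>)

lemma fps_mult_nth_cong:
  "(\<And>k. k \<le> n \<Longrightarrow> F $ k = F' $ k) \<Longrightarrow> (\<And>k. k \<le> n \<Longrightarrow> G $ k = G' $ k) \<Longrightarrow>
    (F * G) $ n = (F' * G') $ n"
  by (simp add: fps_mult_nth)

text \<open>Sums and products respect congruence modulo X^N. This makes y -> X phi(y) a
  contraction.\<close>

lemma polymap_local:
  fixes \<phi> :: "('i \<Rightarrow> 'a::comm_ring_1 fps) \<Rightarrow> 'a fps"
  assumes "polymap K I \<phi>" and "\<And>i k. i \<in> I \<Longrightarrow> k < N \<Longrightarrow> y i $ k = z i $ k" and "k < N"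
  shows "\<phi> y $ k = \<phi> z $ k"
  using assms(1,3)
proof (induction arbitrary: k)
  case (mult \<phi> \<psi>)
  then show ?case by (intro fps_mult_nth_cong) auto
qed (use assms(2) in auto)

text \<open>A product is handled by phi(y) (psi(y) - psi(z)) + psi(z) (phi(y) - phi(z)). The
  cofactors provide the matrix \<open>U\<close> of \<open>lagrange_good\<close>.\<close>

lemma polymap_difference:
  fixes \<phi> :: "('i \<Rightarrow> laurent fps) \<Rightarrow> laurent fps"
  assumes "polymap K I \<phi>" and C: "graded C" and K: "K \<subseteq> supported C" and I: "finite I"
    and yz: "\<And>i. i \<in> I \<Longrightarrow> y i \<in> supported C" "\<And>i. i \<in> I \<Longrightarrow> z i \<in> supported C"
  shows "\<exists>U. (\<forall>i\<in>I. U i \<in> supported C) \<and> \<phi> y - \<phi> z = (\<Sum>i\<in>I. U i * (y i - z i))"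
  using assms(1)
proof induction
  case (const c)
  show ?case by (intro exI[of _ "\<lambda>_. 0"]) simp
next
  case (proj i)
  have "(\<Sum>j\<in>I. (if j = i then 1 else 0) * (y j - z j)) = y i - z i"
    using I proj by (simp add: if_distrib[of "\<lambda>x. x * _"] cong: if_cong)
  then show ?case
    by (intro exI[of _ "\<lambda>j. if j = i then 1 else 0"]) (auto intro: supported_1[OF C])
next
  case (add \<phi> \<psi>)
  then obtain U V where "\<forall>i\<in>I. U i \<in> supported C" "\<phi> y - \<phi> z = (\<Sum>i\<in>I. U i * (y i - z i))"
    "\<forall>i\<in>I. V i \<in> supported C" "\<psi> y - \<psi> z = (\<Sum>i\<in>I. V i * (y i - z i))" by blast
  then show ?case
    by (intro exI[of _ "\<lambda>i. U i + V i"])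
      (auto intro: supported_add simp: distrib_right sum.distrib add_diff_add)
next
  case (mult \<phi> \<psi>)
  then obtain U V where U: "\<forall>i\<in>I. U i \<in> supported C" "\<phi> y - \<phi> z = (\<Sum>i\<in>I. U i * (y i - z i))"
    and V: "\<forall>i\<in>I. V i \<in> supported C" "\<psi> y - \<psi> z = (\<Sum>i\<in>I. V i * (y i - z i))" by blast
  have "\<phi> y * \<psi> y - \<phi> z * \<psi> z = \<phi> y * (\<psi> y - \<psi> z) + \<psi> z * (\<phi> y - \<phi> z)"
    by (simp add: algebra_simps)
  also have "\<dots> = (\<Sum>i\<in>I. (\<phi> y * V i + \<psi> z * U i) * (y i - z i))"
    unfolding U(2) V(2) sum_distrib_left sum.distrib[symmetric]
    by (intro sum.cong refl) (simp add: algebra_simps)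
  finally have "\<phi> y * \<psi> y - \<phi> z * \<psi> z = (\<Sum>i\<in>I. (\<phi> y * V i + \<psi> z * U i) * (y i - z i))" .
  moreover have "\<phi> y \<in> supported C" "\<psi> z \<in> supported C"
    using polymap_supported[OF mult.hyps(1) C K yz(1)] polymap_supported[OF mult.hyps(2) C K yz(2)]
    by simp_all
  then have "\<forall>i\<in>I. \<phi> y * V i + \<psi> z * U i \<in> supported C"
    using U(1) V(1) by (auto intro!: supported_add supported_times[OF C])
  ultimately show ?case by (intro exI[of _ "\<lambda>i. \<phi> y * V i + \<psi> z * U i"] conjI)
qed

text \<open>Iterating y -> X phi(y) from 0 settles one further coefficient in each step and stays in
  the subring \<open>supported\<close>.\<close>

lemma ex_polymap_fixpoint:
  fixes \<phi> :: "'i \<Rightarrow> ('i \<Rightarrow> laurent fps) \<Rightarrow> laurent fps"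
  assumes \<phi>: "\<And>i. i \<in> I \<Longrightarrow> polymap K I (\<phi> i)"
    and K: "K \<subseteq> supported (\<lambda>_. C)" and C: "graded (\<lambda>_. C)"
  shows "\<exists>Y. \<forall>i\<in>I. Y i = fps_X * \<phi> i Y \<and> Y i \<in> supported (\<lambda>_. C)"
proof -
  define Z where "Z k = ((\<lambda>y i. fps_X * \<phi> i y) ^^ k) (\<lambda>_. 0)" for k
  have Z_Suc: "Z (Suc k) i = fps_X * \<phi> i (Z k)" for k i by (simp add: Z_def)
  have agree: "\<forall>i\<in>I. \<forall>N<k. Z (k + m) i $ N = Z k i $ N" for k m
  proof (induction k)
    case (Suc k)
    show ?case
    proof (intro ballI allI impI)
      fix i N assume i: "i \<in> I" and "N < Suc k"
      then show "Z (Suc k + m) i $ N = Z (Suc k) i $ N"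
        using Suc.IH by (cases N) (auto simp: Z_Suc intro!: polymap_local[OF \<phi>[OF i], of k])
    qed
  qed simp
  \<comment> \<open>By \<open>agree\<close>, the coefficient at \<open>N\<close> no longer changes
    from the iterate \<open>Suc N\<close> on.\<close>
  define Y where "Y i = Abs_fps (\<lambda>N. Z (Suc N) i $ N)" for i
  have Y_Z: "Y i $ N = Z k i $ N" if "i \<in> I" "N < k" for i N k
    using agree[of "Suc N" "k - Suc N"] that by (simp add: Y_def)
  have "fps_X \<in> supported (\<lambda>_. C)"
    using C by (auto simp: supported_def graded_def fps_X_def)
  then have Z: "\<forall>i\<in>I. Z k i \<in> supported (\<lambda>_. C)" for k
  proof (induction k)
    case (Suc k)
    then show ?case by (auto simp: Z_Suc intro!: supported_times[OF C] polymap_supported[OF \<phi> C K])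
  qed (simp add: Z_def)
  have "Y i = fps_X * \<phi> i Y" if i: "i \<in> I" for i
  proof (rule fps_ext)
    fix N
    show "Y i $ N = (fps_X * \<phi> i Y) $ N"
    proof (cases N)
      case (Suc M)
      have "Y i $ N = \<phi> i (Z N) $ M" by (simp add: Y_def Z_Suc Suc)
      also have "\<dots> = \<phi> i Y $ M"
        by (rule polymap_local[OF \<phi>[OF i], of N]) (simp_all add: Suc Y_Z)
      finally show ?thesis by (simp add: Suc)
    qed (simp add: Y_def Z_Suc)
  qed
  moreover have "Y i \<in> supported (\<lambda>_. C)" if i: "i \<in> I" for i
  proof -
    have "keys (Z (Suc N) i $ N) \<subseteq> C" for N
      using Z[of "Suc N"] i unfolding supported_def by blast
    then show ?thesis by (simp add: supported_def Y_def)
  qed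
  ultimately show ?thesis by blast
qed

lemma lpolys_mono:
  assumes "u \<le> v"
  shows "lpolys u \<subseteq> lpolys v"
proof -
  have "supported (box u) \<subseteq> supported (box v)"
    using assms by (intro supported_mono) (auto simp: box_def)
  then show ?thesis by (auto simp: lpolys_def)
qed

text \<open>In \<open>lp\<close> the factor \<open>fps_X\<close> pays for negative exponents in the
  coefficients of \<phi>; \<open>v\<close> is arbitrary because the number of unknowns,
  \<open>card I\<close>, only enters in the proof as v = n + card I. The summand \<open>c\<close>
  leaves room for the empty path.\<close>

theorem polymap_system_lrational:
  fixes \<phi> :: "'i \<Rightarrow> ('i \<Rightarrow> laurent fps) \<Rightarrow> laurent fps"
  assumes I: "finite I" and \<phi>: "\<And>i. i \<in> I \<Longrightarrow> polymap (coefficient_part n) I (\<phi> i)"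
    and lp: "\<And>i v y. i \<in> I \<Longrightarrow> n \<le> v \<Longrightarrow> (\<And>j. j \<in> I \<Longrightarrow> y j \<in> lpolys v) \<Longrightarrow>
      fps_X * \<phi> i y \<in> lpolys v"
  obtains Y where "\<And>i. i \<in> I \<Longrightarrow> Y i = fps_X * \<phi> i Y"
    and "\<And>i c. i \<in> I \<Longrightarrow> c \<in> coefficient_part n \<Longrightarrow> c \<in> lpolys n \<Longrightarrow>
      \<exists>v F. lrational v F \<and> ct F = ct (c + Y i)"
proof -
  define d where "d = card I"
  obtain h where h: "bij_betw h {..<d} I"
    using ex_bij_betw_nat_finite[OF I] by (auto simp: d_def atLeast0LessThan)
  define g where "g = the_inv_into {..<d} h"
  have hI: "h k \<in> I" if "k < d" for k using that h by (auto simp: bij_betw_def)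
  have gh: "g (h k) = k" if "k < d" for k
    using that h by (simp add: g_def bij_betw_def the_inv_into_f_f)
  have g: "g i < d" "h (g i) = i" if i: "i \<in> I" for i
  proof -
    obtain k where "k < d" "i = h k" using i h unfolding bij_betw_def by blast
    then show "g i < d" "h (g i) = i" by (simp_all add: gh)
  qed
  let ?y = "\<lambda>i. unknown (n + g i)"
  have "graded (\<lambda>_. {\<alpha> :: expo. keys \<alpha> \<subseteq> {..<n}})"
    unfolding graded_def using Poly_Mapping.keys_add by fastforce
  then obtain Y where Y: "\<And>i. i \<in> I \<Longrightarrow> Y i = fps_X * \<phi> i Y"
    "\<And>i. i \<in> I \<Longrightarrow> Y i \<in> coefficient_part n"
    using ex_polymap_fixpoint[of I "coefficient_part n" \<phi>, OF \<phi> subset_refl] by blast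
  define e where "e k = fps_X * \<phi> (h k) ?y" for k
  have e0: "e k $ 0 = 0" for k by (simp add: e_def)
  have X: "fps_X \<in> supported (nonneg n d)"
    by (auto simp: supported_def nonneg_def fps_X_def)
  have e_nonneg: "e k \<in> supported (nonneg n d)" if "k < d" for k
    unfolding e_def
    by (intro supported_times[OF graded_nonneg] X polymap_supported[OF \<phi>[OF hI[OF that]] graded_nonneg]
        coefficient_part_nonneg unknown_supported_nonneg)
  have "unknown (n + g i) \<in> lpolys (n + d)" if "i \<in> I" for i
    using g(1)[OF that]
    by (auto simp: lpolys_def supported_def box_def monom_fps_def lookup_single when_def)
  then have e_lp: "e k \<in> lpolys (n + d)" if "k < d" for k
    unfolding e_def using hI[OF that] by (intro lp) auto
  have "\<forall>k\<in>{..<d}. \<exists>U. (\<forall>j<d. U j \<in> supported (nonneg n d)) \<and>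
      e k - Y (h k) = fps_X * (\<Sum>j<d. U j * (unknown (n + j) - Y (h j)))"
  proof
    fix k assume "k \<in> {..<d}"
    then have k: "k < d" by simp
    obtain U where U: "\<forall>i\<in>I. U i \<in> supported (nonneg n d)"
      "\<phi> (h k) ?y - \<phi> (h k) Y = (\<Sum>i\<in>I. U i * (?y i - Y i))"
      using polymap_difference[OF \<phi>[OF hI[OF k]] graded_nonneg coefficient_part_nonneg I,
          of ?y d Y] Y(2) coefficient_part_nonneg unknown_supported_nonneg by blast
    have "(\<Sum>i\<in>I. U i * (?y i - Y i)) = (\<Sum>j<d. U (h j) * (?y (h j) - Y (h j)))"
      using sum.reindex_bij_betw[OF h, of "\<lambda>i. U i * (?y i - Y i)"] by simp
    also have "\<dots> = (\<Sum>j<d. U (h j) * (unknown (n + j) - Y (h j)))"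
      by (intro sum.cong) (simp_all add: gh)
    finally have eq: "\<phi> (h k) ?y - \<phi> (h k) Y = (\<Sum>j<d. U (h j) * (unknown (n + j) - Y (h j)))"
      by (simp only: U(2))
    have "e k - Y (h k) = fps_X * (\<phi> (h k) ?y - \<phi> (h k) Y)"
      by (subst Y(1)[OF hI[OF k]]) (simp only: e_def right_diff_distrib)
    then have "e k - Y (h k) = fps_X * (\<Sum>j<d. U (h j) * (unknown (n + j) - Y (h j)))"
      by (simp only: eq)
    moreover have "\<forall>j<d. U (h j) \<in> supported (nonneg n d)" using U(1) hI by blast
    ultimately show "\<exists>U. (\<forall>j<d. U j \<in> supported (nonneg n d)) \<and>
        e k - Y (h k) = fps_X * (\<Sum>j<d. U j * (unknown (n + j) - Y (h j)))"
      by (intro exI[of _ "\<lambda>j. U (h j)"] conjI)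
  qed
  from bchoice[OF this] obtain U where U: "\<And>k j. k < d \<Longrightarrow> j < d \<Longrightarrow> U k j \<in> supported (nonneg n d)"
    "\<And>k. k < d \<Longrightarrow> e k - Y (h k) = fps_X * (\<Sum>j<d. U k j * (unknown (n + j) - Y (h j)))"
    by auto
  have "\<exists>H. H * (1 - e k * unknown_inv (n + k)) = 1" for k
    by (rule ex_inverse_one_minus) (simp add: e0)
  then obtain H where H: "\<And>k. H k * (1 - e k * unknown_inv (n + k)) = 1" by metis
  show thesis
  proof (rule that[OF Y(1)])
    fix i c assume i: "i \<in> I" and c: "c \<in> coefficient_part n" "c \<in> lpolys n"
    let ?F = "(c + unknown (n + g i)) * (jacobian n d e * (\<Prod>k<d. H k))"
    have "ct ?F = ct (c + Y (h (g i)))"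
      using e_nonneg e0 Y(2)[OF hI] U H c(1) g(1)[OF i] by (rule lagrange_good)
    moreover have "lrational (n + d) ?F"
    proof (rule lrational_lagrange)
      show "c + unknown (n + g i) \<in> lpolys (n + d)"
        using lpolys_mono[of n "n + d"] c(2) \<open>\<And>i. i \<in> I \<Longrightarrow> unknown (n + g i) \<in> lpolys (n + d)\<close>[OF i]
        by (auto intro: lpolys_add)
    qed (use e_nonneg e0 e_lp H in auto)
    ultimately show "\<exists>v F. lrational v F \<and> ct F = ct (c + Y i)"
      using g(2)[OF i] by auto
  qed
qed

subsection \<open>Paths labelled by elements of a free group\<close>

text \<open>The word is the label still to be spelled, so an edge with letter b leaves the product
  of the inverse of b with it.\<close>

fun act :: "('l \<times> bool) option \<Rightarrow> ('l \<times> bool) list \<Rightarrow> ('l \<times> bool) list" where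
  "act None u = u"
| "act (Some b) u = reduced_Cons (inv_letter b) u"

text \<open>
  The weighted number of paths of length \<open>N\<close> from \<open>\<sigma>\<close> to a final state whose label is the element
  \<open>u\<close> of the free group.  An edge consists of a tag (which allows parallel edges), a monomial, an
  optional letter, and a target.
\<close>

fun walks :: "('s \<Rightarrow> ('t \<times> expo \<times> ('l \<times> bool) option \<times> 's) set) \<Rightarrow> 's set \<Rightarrow>
    nat \<Rightarrow> 's \<Rightarrow> ('l \<times> bool) list \<Rightarrow> laurent" where
  "walks E Fin 0 \<sigma> u = (if \<sigma> \<in> Fin \<and> u = [] then 1 else 0)"
| "walks E Fin (Suc N) \<sigma> u = (\<Sum>(t, w, b, \<tau>)\<in>E \<sigma>. single w 1 * walks E Fin N \<tau> (act b u))"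

text \<open>
  The unknown \<open>Inl (a, \<sigma>, \<rho>)\<close> enumerates the first-passage paths with label \<open>a\<close> from \<open>\<sigma>\<close> to \<open>\<rho>\<close>, and
  \<open>Inr \<sigma>\<close> the nonempty paths with trivial label from \<open>\<sigma>\<close> to a final state.
\<close>

fun passage_map :: "('s \<Rightarrow> ('t \<times> expo \<times> ('l \<times> bool) option \<times> 's) set) \<Rightarrow> 's set \<Rightarrow> 's set \<Rightarrow>
    ('l \<times> bool) \<times> 's \<times> 's + 's \<Rightarrow> (('l \<times> bool) \<times> 's \<times> 's + 's \<Rightarrow> laurent fps) \<Rightarrow> laurent fps" where
  "passage_map E S Fin (Inl (a, \<sigma>, \<rho>)) y = (\<Sum>(t, w, b, \<tau>)\<in>E \<sigma>. monom_fps w *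
    (case b of None \<Rightarrow> y (Inl (a, \<tau>, \<rho>))
     | Some b \<Rightarrow> if b = a then (if \<tau> = \<rho> then 1 else 0)
         else (\<Sum>\<pi>\<in>S. y (Inl (inv_letter b, \<tau>, \<pi>)) * y (Inl (a, \<pi>, \<rho>)))))"
| "passage_map E S Fin (Inr \<sigma>) y = (\<Sum>(t, w, b, \<tau>)\<in>E \<sigma>. monom_fps w *
    (case b of None \<Rightarrow> (if \<tau> \<in> Fin then 1 else 0) + y (Inr \<tau>)
     | Some b \<Rightarrow> (\<Sum>\<pi>\<in>S. y (Inl (inv_letter b, \<tau>, \<pi>)) * ((if \<pi> \<in> Fin then 1 else 0) + y (Inr \<pi>)))))"

text \<open>The word still to be spelled is a stack onto which inverse letters are pushed; hence
  \<open>A\<close> is closed under inverses. Every edge counts as one factor \<open>X\<close>, which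
  admits exponents down to -1, hence \<open>box n 1\<close>.\<close>

locale pushdown =
  fixes E :: "'s \<Rightarrow> ('t \<times> expo \<times> ('l \<times> bool) option \<times> 's) set"
    and S Fin :: "'s set" and A :: "('l \<times> bool) set" and n :: nat
  assumes finite_S: "finite S" and finite_A: "finite A"
    and inv_A: "\<And>a. a \<in> A \<Longrightarrow> inv_letter a \<in> A"
    and finite_E: "\<And>\<sigma>. \<sigma> \<in> S \<Longrightarrow> finite (E \<sigma>)"
    and target: "\<And>\<sigma> t w b \<tau>. \<sigma> \<in> S \<Longrightarrow> (t, w, b, \<tau>) \<in> E \<sigma> \<Longrightarrow> \<tau> \<in> S"
    and weight: "\<And>\<sigma> t w b \<tau>. \<sigma> \<in> S \<Longrightarrow> (t, w, b, \<tau>) \<in> E \<sigma> \<Longrightarrow> w \<in> box n 1"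
    and letter: "\<And>\<sigma> t w b \<tau>. \<sigma> \<in> S \<Longrightarrow> (t, w, Some b, \<tau>) \<in> E \<sigma> \<Longrightarrow> b \<in> A"
begin

definition I :: "(('l \<times> bool) \<times> 's \<times> 's + 's) set" where
  "I = Inl ` (A \<times> S \<times> S) \<union> Inr ` S"

lemma I_iff [simp]:
  "Inl (a, \<sigma>, \<rho>) \<in> I \<longleftrightarrow> a \<in> A \<and> \<sigma> \<in> S \<and> \<rho> \<in> S" "Inr \<sigma> \<in> I \<longleftrightarrow> \<sigma> \<in> S"
  by (auto simp: I_def)

lemma I_cases:
  assumes "i \<in> I"
  obtains a \<sigma> \<rho> where "i = Inl (a, \<sigma>, \<rho>)" "a \<in> A" "\<sigma> \<in> S" "\<rho> \<in> S"
    | \<sigma> where "i = Inr \<sigma>" "\<sigma> \<in> S"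
  using assms by (auto simp: I_def)

lemma coefficient_01: "(if P then 1 else 0) \<in> coefficient_part n"
  by (simp add: supported_def)

lemma polymap_passage:
  assumes "i \<in> I"
  shows "polymap (coefficient_part n) I (passage_map E S Fin i)"
proof -
  have w: "monom_fps w \<in> coefficient_part n" if "\<sigma> \<in> S" "(t, w, b, \<tau>) \<in> E \<sigma>" for \<sigma> t w b \<tau>
    using weight[OF that] by (auto simp: supported_def monom_fps_def box_def)
  show ?thesis
    using assms
  proof (cases rule: I_cases)
    case (1 a \<sigma> \<rho>)
    have "polymap (coefficient_part n) I (\<lambda>y. case e of (t, w, b, \<tau>) \<Rightarrow> monom_fps w *
        (case b of None \<Rightarrow> y (Inl (a, \<tau>, \<rho>))
         | Some b \<Rightarrow> if b = a then (if \<tau> = \<rho> then 1 else 0)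
             else (\<Sum>\<pi>\<in>S. y (Inl (inv_letter b, \<tau>, \<pi>)) * y (Inl (a, \<pi>, \<rho>)))))"
      if e: "e \<in> E \<sigma>" for e
    proof (cases e)
      case (fields t w b \<tau>)
      note e' = e[unfolded fields]
      note * = w[OF 1(3) e'] target[OF 1(3) e']
      show ?thesis
      proof (cases b)
        case None
        with * 1 show ?thesis by (auto simp: fields intro!: polymap.intros)
      next
        case (Some c)
        with letter[OF 1(3), of t w c \<tau>] e' have "c \<in> A" by simp
        with * 1 Some show ?thesis
          by (cases "c = a")
            (auto simp: fields coefficient_01 inv_A intro!: polymap.intros polymap_sum)
      qed
    qed
    then show ?thesis
      unfolding 1(1) passage_map.simps by (intro polymap_sum) simp_all
  next
    case (2 \<sigma>)
    have "polymap (coefficient_part n) I (\<lambda>y. case e of (t, w, b, \<tau>) \<Rightarrow> monom_fps w *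
        (case b of None \<Rightarrow> (if \<tau> \<in> Fin then 1 else 0) + y (Inr \<tau>)
         | Some b \<Rightarrow> (\<Sum>\<pi>\<in>S. y (Inl (inv_letter b, \<tau>, \<pi>)) * ((if \<pi> \<in> Fin then 1 else 0) + y (Inr \<pi>)))))"
      if e: "e \<in> E \<sigma>" for e
    proof (cases e)
      case (fields t w b \<tau>)
      note e' = e[unfolded fields]
      note * = w[OF 2(2) e'] target[OF 2(2) e']
      show ?thesis
      proof (cases b)
        case None
        with * 2 show ?thesis
          unfolding fields by (simp only: prod.case option.case) (intro polymap.intros coefficient_01, simp_all)
      next
        case (Some c)
        with letter[OF 2(2), of t w c \<tau>] e' have "c \<in> A" by simp
        with * 2 Some show ?thesis
          unfolding fields
          by (simp only: prod.case option.case)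
            (intro polymap.intros polymap_sum coefficient_01, simp_all add: inv_A)
      qed
    qed
    then show ?thesis
      unfolding 2(1) passage_map.simps by (intro polymap_sum) simp_all
  qed
qed

lemma lpolys_01: "(if P then 1 else 0) \<in> lpolys v"
  by simp

lemma lpolys_passage:
  assumes "i \<in> I" and v: "n \<le> v" and y: "\<And>j. j \<in> I \<Longrightarrow> y j \<in> lpolys v"
  shows "fps_X * passage_map E S Fin i y \<in> lpolys v"
proof -
  \<comment> \<open>An exponent -1 is outside \<open>box\<close> in degree 0 and becomes admissible
    with the factor \<open>fps_X\<close>.\<close>
  have w: "fps_X * monom_fps w \<in> lpolys v" if "\<sigma> \<in> S" "(t, w, b, \<tau>) \<in> E \<sigma>" for \<sigma> t w b \<tau>
    using weight[OF that] v
    by (auto simp: lpolys_def supported_def monom_fps_def fps_X_def box_def intro!: exI[of _ 1])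
  have sum: "fps_X * (\<Sum>(t, w, b, \<tau>)\<in>E \<sigma>. monom_fps w * f b \<tau>) \<in> lpolys v"
    if \<sigma>: "\<sigma> \<in> S" and f: "\<And>t w b \<tau>. (t, w, b, \<tau>) \<in> E \<sigma> \<Longrightarrow> f b \<tau> \<in> lpolys v" for \<sigma> f
  proof -
    have "fps_X * (\<Sum>(t, w, b, \<tau>)\<in>E \<sigma>. monom_fps w * f b \<tau>)
        = (\<Sum>(t, w, b, \<tau>)\<in>E \<sigma>. fps_X * monom_fps w * f b \<tau>)"
      by (simp add: sum_distrib_left case_prod_unfold mult.assoc)
    also have "\<dots> \<in> lpolys v"
      by (intro lpolys_sum) (auto intro: lpolys_times[OF w[OF \<sigma>] f])
    finally show ?thesis .
  qed
  show ?thesis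
    using assms(1)
  proof (cases rule: I_cases)
    case (1 a \<sigma> \<rho>)
    show ?thesis
      unfolding 1(1) passage_map.simps
    proof (rule sum[OF 1(3)])
      fix t w b \<tau> assume e: "(t, w, b, \<tau>) \<in> E \<sigma>"
      show "(case b of None \<Rightarrow> y (Inl (a, \<tau>, \<rho>))
         | Some b \<Rightarrow> if b = a then (if \<tau> = \<rho> then 1 else 0)
             else (\<Sum>\<pi>\<in>S. y (Inl (inv_letter b, \<tau>, \<pi>)) * y (Inl (a, \<pi>, \<rho>)))) \<in> lpolys v"
        using 1 target[OF 1(3) e] letter[OF 1(3), of t w _ \<tau>] e inv_A
        by (cases b) (auto simp del: split_paired_All intro!: y lpolys_sum lpolys_times)
    qed
  next
    case (2 \<sigma>)
    show ?thesis
      unfolding 2(1) passage_map.simps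
    proof (rule sum[OF 2(2)])
      fix t w b \<tau> assume e: "(t, w, b, \<tau>) \<in> E \<sigma>"
      show "(case b of None \<Rightarrow> (if \<tau> \<in> Fin then 1 else 0) + y (Inr \<tau>)
         | Some b \<Rightarrow> (\<Sum>\<pi>\<in>S. y (Inl (inv_letter b, \<tau>, \<pi>)) * ((if \<pi> \<in> Fin then 1 else 0) + y (Inr \<pi>))))
         \<in> lpolys v"
        using target[OF 2(2) e] letter[OF 2(2), of t w _ \<tau>] e inv_A
        by (cases b)
          (auto simp del: if_split split_paired_All intro!: y lpolys_sum lpolys_times lpolys_add lpolys_01)
    qed
  qed
qed

lemma act_lists:
  assumes "u \<in> lists A" "\<And>c. b = Some c \<Longrightarrow> c \<in> A"
  shows "act b u \<in> lists A"
proof (cases b)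
  case (Some c)
  have "set u \<subseteq> A" "inv_letter c \<in> A" using assms Some by (auto intro: inv_A)
  with set_reduced_Cons[of "inv_letter c" u] have "set (reduced_Cons (inv_letter c) u) \<subseteq> A" by blast
  then show ?thesis by (simp add: Some lists_eq_set)
qed (use assms in simp)

text \<open>No bijection between paths is constructed. The series \<open>V u\<close>, a product of
  first-passage matrices for the letters of \<open>u\<close> applied to the vector
  \<open>V []\<close>, is shown to satisfy the one-step recursion that defines \<open>walks\<close>;
  this determines all coefficients.\<close>

theorem walks_lrational:
  assumes \<sigma>0: "\<sigma>0 \<in> S"
  shows "\<exists>v F. lrational v F \<and> (\<forall>N. ct F $ N = lookup (walks E Fin N \<sigma>0 []) 0)"
proof -
  have finite_I: "finite I" using finite_S finite_A by (simp add: I_def)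
  obtain Y where Y: "\<And>i. i \<in> I \<Longrightarrow> Y i = fps_X * passage_map E S Fin i Y"
    and rat: "\<And>i c. i \<in> I \<Longrightarrow> c \<in> coefficient_part n \<Longrightarrow> c \<in> lpolys n \<Longrightarrow>
      \<exists>v F. lrational v F \<and> ct F = ct (c + Y i)"
    using polymap_system_lrational[of I n "passage_map E S Fin", OF finite_I polymap_passage lpolys_passage]
    by blast
  define fin :: "'s \<Rightarrow> laurent fps" where "fin \<sigma> = (if \<sigma> \<in> Fin then 1 else 0)" for \<sigma>
  define V where "V = rec_list (\<lambda>\<sigma>. fin \<sigma> + Y (Inr \<sigma>))
    (\<lambda>a u f \<sigma>. \<Sum>\<rho>\<in>S. Y (Inl (a, \<sigma>, \<rho>)) * f \<rho>)"
  have V_Nil: "V [] \<sigma> = fin \<sigma> + Y (Inr \<sigma>)" for \<sigma> by (simp add: V_def)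
  have V_Cons: "V (a # u) \<sigma> = (\<Sum>\<rho>\<in>S. Y (Inl (a, \<sigma>, \<rho>)) * V u \<rho>)" for a u \<sigma>
    by (simp add: V_def)
  have rec: "V u \<sigma> = (if u = [] then fin \<sigma> else 0)
      + fps_X * (\<Sum>(t, w, b, \<tau>)\<in>E \<sigma>. monom_fps w * V (act b u) \<tau>)"
    if \<sigma>: "\<sigma> \<in> S" and u: "u \<in> lists A" for \<sigma> u
  proof (cases u)
    case Nil
    have step: "(case b of None \<Rightarrow> (if \<tau> \<in> Fin then 1 else 0) + Y (Inr \<tau>)
          | Some b \<Rightarrow> (\<Sum>\<pi>\<in>S. Y (Inl (inv_letter b, \<tau>, \<pi>)) *
              ((if \<pi> \<in> Fin then 1 else 0) + Y (Inr \<pi>))))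
        = V (act b []) \<tau>" for b \<tau>
      by (cases b) (simp_all only: act.simps reduced_Cons.simps V_Nil V_Cons fin_def option.case)
    have "Y (Inr \<sigma>) = fps_X * (\<Sum>(t, w, b, \<tau>)\<in>E \<sigma>. monom_fps w * V (act b []) \<tau>)"
      using Y[of "Inr \<sigma>"] \<sigma> by (simp only: passage_map.simps step I_iff)
    then show ?thesis by (simp add: Nil V_Nil)
  next
    case (Cons a u')
    then have a: "a \<in> A" using u by simp
    define K where "K b \<tau> \<rho> = (case b of None \<Rightarrow> Y (Inl (a, \<tau>, \<rho>))
        | Some b \<Rightarrow> if b = a then (if \<tau> = \<rho> then 1 else 0)
           else (\<Sum>\<pi>\<in>S. Y (Inl (inv_letter b, \<tau>, \<pi>)) * Y (Inl (a, \<pi>, \<rho>))))" for b \<tau> \<rho>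
    \<comment> \<open>After a first edge with a letter c other than a, the Cayley tree forces the
      path to pass back through the inverse of c before it can reach a; on the stack this is the
      word \<open>inv_letter c # a # u'\<close>.\<close>
    have K: "(\<Sum>\<rho>\<in>S. K b \<tau> \<rho> * V u' \<rho>) = V (act b u) \<tau>" if \<tau>: "\<tau> \<in> S" for b \<tau>
    proof (cases b)
      case None
      then show ?thesis by (simp add: K_def Cons V_Cons)
    next
      case (Some c)
      show ?thesis
      proof (cases "c = a")
        case True
        then show ?thesis
          using \<tau> finite_S by (simp add: K_def Cons Some if_distrib[of "\<lambda>x. x * _"] cong: if_cong)
      next
        case False
        have "(\<Sum>\<rho>\<in>S. K b \<tau> \<rho> * V u' \<rho>)
            = (\<Sum>\<rho>\<in>S. \<Sum>\<pi>\<in>S. Y (Inl (inv_letter c, \<tau>, \<pi>)) * (Y (Inl (a, \<pi>, \<rho>)) * V u' \<rho>))"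
          using False by (simp add: K_def Some sum_distrib_right mult.assoc)
        also have "\<dots> = (\<Sum>\<pi>\<in>S. Y (Inl (inv_letter c, \<tau>, \<pi>)) * V (a # u') \<pi>)"
          by (subst sum.swap) (simp add: V_Cons sum_distrib_left)
        also have "\<dots> = V (inv_letter c # a # u') \<tau>" by (simp only: V_Cons)
        finally show ?thesis using False by (simp add: Some Cons)
      qed
    qed
    have "V u \<sigma> = (\<Sum>\<rho>\<in>S. fps_X * (\<Sum>(t, w, b, \<tau>)\<in>E \<sigma>. monom_fps w * K b \<tau> \<rho>) * V u' \<rho>)"
      unfolding Cons V_Cons
    proof (rule sum.cong[OF refl])
      fix \<rho> assume "\<rho> \<in> S"
      then have "Y (Inl (a, \<sigma>, \<rho>)) = fps_X * (\<Sum>(t, w, b, \<tau>)\<in>E \<sigma>. monom_fps w * K b \<tau> \<rho>)"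
        using Y[of "Inl (a, \<sigma>, \<rho>)"] a \<sigma> by (simp add: K_def)
      then show "Y (Inl (a, \<sigma>, \<rho>)) * V u' \<rho>
          = fps_X * (\<Sum>(t, w, b, \<tau>)\<in>E \<sigma>. monom_fps w * K b \<tau> \<rho>) * V u' \<rho>" by simp
    qed
    also have "\<dots> = fps_X * (\<Sum>\<rho>\<in>S. \<Sum>(t, w, b, \<tau>)\<in>E \<sigma>. monom_fps w * (K b \<tau> \<rho> * V u' \<rho>))"
      by (simp add: sum_distrib_left sum_distrib_right case_prod_unfold mult.assoc)
    also have "\<dots> = fps_X * (\<Sum>(t, w, b, \<tau>)\<in>E \<sigma>. monom_fps w * (\<Sum>\<rho>\<in>S. K b \<tau> \<rho> * V u' \<rho>))"
      by (subst sum.swap) (simp add: sum_distrib_left case_prod_unfold)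
    also have "\<dots> = fps_X * (\<Sum>(t, w, b, \<tau>)\<in>E \<sigma>. monom_fps w * V (act b u) \<tau>)"
      using target[OF \<sigma>] K by (intro arg_cong2[where f = times] refl sum.cong) auto
    finally show ?thesis by (simp add: Cons)
  qed
  have walks: "V u \<sigma> $ N = walks E Fin N \<sigma> u" if "\<sigma> \<in> S" "u \<in> lists A" for N \<sigma> u
    using that
  proof (induction N arbitrary: \<sigma> u)
    case 0
    then show ?case by (simp add: rec[OF 0] fin_def)
  next
    case (Suc N)
    have "V u \<sigma> $ Suc N = (\<Sum>(t, w, b, \<tau>)\<in>E \<sigma>. single w 1 * V (act b u) \<tau> $ N)"
      by (subst rec[OF Suc.prems]) (auto simp: fin_def fps_sum_nth monom_fps_def case_prod_unfold)
    also have "\<dots> = walks E Fin (Suc N) \<sigma> u"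
      unfolding walks.simps
    proof (intro sum.cong refl)
      fix e assume "e \<in> E \<sigma>"
      then obtain t w b \<tau> where e: "e = (t, w, b, \<tau>)" "(t, w, b, \<tau>) \<in> E \<sigma>" by (cases e) auto
      have "act b u \<in> lists A"
        using letter[OF Suc.prems(1)] e(2) by (intro act_lists Suc.prems) auto
      with target[OF Suc.prems(1) e(2)] have "V (act b u) \<tau> $ N = walks E Fin N \<tau> (act b u)"
        by (rule Suc.IH)
      then show "(case e of (t, w, b, \<tau>) \<Rightarrow> single w 1 * V (act b u) \<tau> $ N)
          = (case e of (t, w, b, \<tau>) \<Rightarrow> single w 1 * walks E Fin N \<tau> (act b u))"
        by (simp add: e(1))
    qed
    finally show ?case .
  qed
  \<comment> \<open>The unknown \<open>Inr\<close> omits the empty path, which is restored by the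
    summand \<open>c\<close>.\<close>
  have "fin \<sigma>0 \<in> coefficient_part n" "fin \<sigma>0 \<in> lpolys n"
    by (simp_all add: fin_def supported_def)
  then obtain v F where F: "lrational v F" "ct F = ct (fin \<sigma>0 + Y (Inr \<sigma>0))"
    using rat[of "Inr \<sigma>0" "fin \<sigma>0"] \<sigma>0 by auto
  then have "ct F $ N = lookup (walks E Fin N \<sigma>0 []) 0" for N
    using walks[OF \<sigma>0, of "[]" N] by (simp add: V_Nil)
  with F(1) show ?thesis by blast
qed

end

subsection \<open>Groups that are virtually a product\<close>

lemma lookup_single_times:
  fixes f :: laurent
  shows "lookup (single \<beta> 1 * f) \<alpha> = lookup f (\<alpha> - \<beta>)"
  using lookup_times_single[of f \<beta> 1] by (simp add: mult.commute)

text \<open>Each step multiplies on the left by the inverse of its letter, so the letters put in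
  front of \<open>u\<close> are consumed in their own order.\<close>

lemma acts_cancel:
  fixes es :: "('e \<times> ('l \<times> bool) option) list"
  assumes "freely_reduced u"
  shows "foldl (\<lambda>u s. act (snd s) u) (foldr reduced_Cons (List.map_filter snd es) u) es = u"
proof (induction es)
  case (Cons s es)
  show ?case
  proof (cases "snd s")
    case (Some b)
    have "reduced_Cons (inv_letter b) (reduced_Cons b (foldr reduced_Cons (List.map_filter snd es) u))
        = foldr reduced_Cons (List.map_filter snd es) u"
      using reduced_Cons_cancel[of "foldr reduced_Cons (List.map_filter snd es) u" "inv_letter b"]
      by (simp add: freely_reduced_foldr assms)
    then show ?thesis using Cons.IH Some by (simp add: List.map_filter_simps)
  qed (use Cons.IH in \<open>simp add: List.map_filter_simps\<close>)
qed (simp add: assms List.map_filter_simps)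

text \<open>An edge can lower an exponent by at most one but raise it arbitrarily. So
  \<open>M\<close> steps with all exponents -1 are followed by one correction with nonnegative
  exponents, and then by the letters of \<open>u\<close> one at a time.\<close>

lemma ex_step_list:
  assumes \<alpha>: "keys \<alpha> \<subseteq> {..<n}" and u: "set u \<subseteq> A"
  shows "\<exists>es. set es \<subseteq> box n 1 \<times> (insert None (Some ` A)) \<and> sum_list (map fst es) = \<alpha>
    \<and> List.map_filter snd es = u"
proof -
  define \<beta> :: expo where "\<beta> = (\<Sum>i<n. single i (- 1))"
  have \<beta>: "lookup \<beta> i = (if i < n then - 1 else 0)" for i
    by (simp add: \<beta>_def lookup_sum lookup_single when_def)
  obtain M :: nat where M: "\<And>i. i < n \<Longrightarrow> - int M \<le> lookup \<alpha> i"
  proof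
    fix i assume "i < n"
    then have "nat (- lookup \<alpha> i) \<le> (\<Sum>i<n. nat (- lookup \<alpha> i))"
      by (intro member_le_sum) auto
    then show "- int (\<Sum>i<n. nat (- lookup \<alpha> i)) \<le> lookup \<alpha> i" by linarith
  qed
  have M\<beta>: "lookup (sum_list (replicate M \<beta>)) i = (if i < n then - int M else 0)" for i
    by (induction M) (auto simp: lookup_add \<beta>)
  define rest where "rest = \<alpha> - sum_list (replicate M \<beta>)"
  have rest: "lookup rest i = lookup \<alpha> i + (if i < n then int M else 0)" for i
    by (simp add: rest_def lookup_minus M\<beta>)
  have \<alpha>0: "lookup \<alpha> i = 0" if "i \<ge> n" for i
  proof -
    have "i \<notin> keys \<alpha>" using \<alpha> that by auto
    then show ?thesis by (simp add: in_keys_iff)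
  qed
  have box: "\<beta> \<in> box n 1" "rest \<in> box n 1"
    using M \<alpha>0 by (auto simp: box_iff \<beta> rest) (smt (verit) linorder_not_less)
  have zero: "0 \<in> box n 1" by (simp add: box_iff)
  let ?l = "replicate M (\<beta>, None) @ (rest, None) # map (\<lambda>b. (0, Some b)) u"
  have sum0: "sum_list (map (\<lambda>b. 0 :: expo) u) = 0" by (induction u) simp_all
  have "sum_list (map fst ?l) = \<alpha>"
    by (simp add: comp_def sum0 rest_def)
  moreover have "List.map_filter snd (map (\<lambda>b. (0 :: expo, Some b)) u) = u"
    by (induction u) (simp_all add: List.map_filter_simps)
  then have "List.map_filter snd ?l = u"
    by (induction M) (simp_all add: List.map_filter_simps)
  moreover have "set ?l \<subseteq> box n 1 \<times> (insert None (Some ` A))"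
    using box zero u by auto
  ultimately show ?thesis by blast
qed

text \<open>
  The maps \<open>\<kappa>\<close> and \<open>\<mu>\<close> are the projections of an embedding of \<open>H\<close> into the product of a free abelian
  group of rank \<open>n\<close> and a free group.
\<close>

locale virtually_product = group G + subgroup H G
  for G (structure) and H +
  fixes \<kappa> :: "'a \<Rightarrow> expo" and \<mu> :: "'a \<Rightarrow> ('l \<times> bool) list"
    and n :: nat and L :: "('l \<times> bool) set"
  assumes finite_index: "finite (rcosets H)"
    and finite_L: "finite L" and inv_L: "\<And>b. b \<in> L \<Longrightarrow> inv_letter b \<in> L"
    and \<kappa>_mult: "\<And>g h. g \<in> H \<Longrightarrow> h \<in> H \<Longrightarrow> \<kappa> (g \<otimes> h) = \<kappa> g + \<kappa> h"
    and \<mu>_mult: "\<And>g h. g \<in> H \<Longrightarrow> h \<in> H \<Longrightarrow> \<mu> (g \<otimes> h) = foldr reduced_Cons (\<mu> g) (\<mu> h)"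
    and \<kappa>_keys: "\<And>h. h \<in> H \<Longrightarrow> keys (\<kappa> h) \<subseteq> {..<n}"
    and \<mu>_set: "\<And>h. h \<in> H \<Longrightarrow> set (\<mu> h) \<subseteq> L"
    and \<mu>_reduced: "\<And>h. h \<in> H \<Longrightarrow> freely_reduced (\<mu> h)"
    and trivial_iff: "\<And>h. h \<in> H \<Longrightarrow> \<kappa> h = 0 \<and> \<mu> h = [] \<longleftrightarrow> h = \<one>"
begin

text \<open>\<open>H\<close> is represented by the identity, so that along a path from
  \<open>H\<close> to \<open>H\<close> the product of the cocycles is the value of the word
  itself.\<close>

definition rep :: "'a set \<Rightarrow> 'a" where
  "rep K = (if K = H then \<one> else (SOME g. g \<in> K))"

text \<open>Schreier's rewriting: the element of \<open>H\<close> contributed by reading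
  \<open>x\<close> at the coset \<open>K\<close>.\<close>

definition cocycle :: "'a set \<Rightarrow> 'a \<Rightarrow> 'a" where
  "cocycle K x = rep K \<otimes> x \<otimes> inv (rep (K #> x))"

lemma rcosetsE:
  assumes "K \<in> rcosets H"
  obtains g where "g \<in> carrier G" "K = H #> g"
  using assms by (auto simp: RCOSETS_def)

lemma H_rcoset: "H \<in> rcosets H"
  using coset_mult_one[OF subset] by (auto simp: RCOSETS_def intro!: bexI[of _ \<one>])

lemma rcoset_mult: "K \<in> rcosets H \<Longrightarrow> x \<in> carrier G \<Longrightarrow> K #> x \<in> rcosets H"
  by (auto elim!: rcosetsE simp: coset_mult_assoc[OF subset] RCOSETS_def)

lemma rep_in: assumes "K \<in> rcosets H" shows "rep K \<in> K"
proof -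
  obtain g where g: "g \<in> carrier G" "K = H #> g" using assms by (rule rcosetsE)
  then have "g \<in> K" using rcos_self[OF g(1) subgroup_axioms] by simp
  then have "(SOME g. g \<in> K) \<in> K" by (rule someI)
  then show ?thesis by (auto simp: rep_def)
qed

lemma rep_closed: assumes "K \<in> rcosets H" shows "rep K \<in> carrier G"
  using rep_in[OF assms] assms rcosets_carrier[OF is_group assms] by blast

lemma rep_H: "rep H = \<one>"
  by (simp add: rep_def)

lemma rcoset_div:
  assumes "K \<in> rcosets H" "a \<in> K" "b \<in> K"
  shows "a \<otimes> inv b \<in> H"
proof -
  obtain g where g: "g \<in> carrier G" "K = H #> g" using assms(1) by (rule rcosetsE)
  with assms obtain h h' where "h \<in> H" "a = h \<otimes> g" "h' \<in> H" "b = h' \<otimes> g"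
    by (auto simp: r_coset_def)
  then show ?thesis
    using g(1) by (simp add: inv_mult_group m_assoc inv_solve_left flip: m_assoc[of g])
qed

lemma rep_in_H_iff:
  assumes "K \<in> rcosets H"
  shows "rep K \<in> H \<longleftrightarrow> K = H"
proof
  assume *: "rep K \<in> H"
  obtain g where g: "g \<in> carrier G" "K = H #> g" using assms by (rule rcosetsE)
  then have "rep K \<in> H #> g" using rep_in[OF assms] by simp
  then have "H #> g = H #> rep K" using g(1) subgroup_axioms by (intro repr_independence)
  also have "\<dots> = H" using * rep_closed[OF assms] by (intro coset_join2 subgroup_axioms)
  finally show "K = H" using g by simp
qed (simp add: rep_H)

lemma cocycle_in:
  assumes "K \<in> rcosets H" "x \<in> carrier G"
  shows "cocycle K x \<in> H"
  unfolding cocycle_def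
proof (rule rcoset_div)
  show "rep K \<otimes> x \<in> K #> x" using rep_in[OF assms(1)] by (auto simp: r_coset_def)
  show "K #> x \<in> rcosets H" by (rule rcoset_mult[OF assms])
  then show "rep (K #> x) \<in> K #> x" by (rule rep_in)
qed

lemma cocycle_eq:
  assumes "K \<in> rcosets H" "x \<in> carrier G"
  shows "rep K \<otimes> x = cocycle K x \<otimes> rep (K #> x)"
  using assms rep_closed[OF rcoset_mult[OF assms]] rep_closed[OF assms(1)]
  by (simp add: cocycle_def m_assoc)

lemma word_value_closed: "w \<in> lists (carrier G) \<Longrightarrow> word_value G w \<in> carrier G"
  by (induction w) (auto simp: word_value_def)

text \<open>Idle steps (0, None) bring all labels to one length. It is a power of two because
  sections are taken by iterating \<open>half\<close>.\<close>

lemma ex_padded_labels: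
  assumes "finite X" "X \<subseteq> carrier G"
  shows "\<exists>s lab. \<forall>K\<in>rcosets H. \<forall>x\<in>X. set (lab K x) \<subseteq> box n 1 \<times> insert None (Some ` L)
    \<and> sum_list (map fst (lab K x)) = \<kappa> (cocycle K x)
    \<and> List.map_filter snd (lab K x) = \<mu> (cocycle K x) \<and> length (lab K x) = 2 ^ s"
proof -
  have "\<exists>es. set es \<subseteq> box n 1 \<times> insert None (Some ` L) \<and> sum_list (map fst es) = \<kappa> (cocycle K x)
      \<and> List.map_filter snd es = \<mu> (cocycle K x)" if "K \<in> rcosets H" "x \<in> X" for K x
    using that assms(2) by (intro ex_step_list \<kappa>_keys \<mu>_set cocycle_in) auto
  then obtain lab where lab: "\<And>K x. K \<in> rcosets H \<Longrightarrow> x \<in> X \<Longrightarrow>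
      set (lab K x) \<subseteq> box n 1 \<times> insert None (Some ` L) \<and>
      sum_list (map fst (lab K x)) = \<kappa> (cocycle K x) \<and>
      List.map_filter snd (lab K x) = \<mu> (cocycle K x)"
    by metis
  \<comment> \<open>The sum of all lengths is a crude bound for each of them, and s <= 2^s.\<close>
  define s where "s = (\<Sum>(K, x)\<in>(rcosets H) \<times> X. length (lab K x))"
  have s: "length (lab K x) \<le> 2 ^ s" if "K \<in> rcosets H" "x \<in> X" for K x
  proof -
    have "(case (K, x) of (K, x) \<Rightarrow> length (lab K x)) \<le> s"
      unfolding s_def using finite_index assms(1) that by (intro member_le_sum) auto
    then have "length (lab K x) \<le> s" by simp
    also have "s \<le> 2 ^ s" by (rule less_imp_le, rule less_exp)
    finally show ?thesis .
  qed
  define lab' where "lab' K x = lab K x @ replicate (2 ^ s - length (lab K x)) (0, None)" for K x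
  have zero: "(0 :: expo) \<in> box n 1" by (simp add: box_iff)
  have 1: "sum_list (map fst (replicate j (0 :: expo, None :: ('l \<times> bool) option))) = 0" for j
    by (induction j) simp_all
  have 2: "List.map_filter snd (es @ replicate j (0 :: expo, None :: ('l \<times> bool) option))
      = List.map_filter snd es" for es j
  proof (induction es)
    case Nil
    show ?case by (induction j) (simp_all add: List.map_filter_simps)
  qed (simp add: List.map_filter_simps split: option.split)
  show ?thesis
  proof (intro exI[of _ s] exI[of _ lab'] ballI conjI)
    fix K x assume Kx: "K \<in> rcosets H" "x \<in> X"
    show "set (lab' K x) \<subseteq> box n 1 \<times> insert None (Some ` L)"
      using lab[OF Kx] zero by (auto simp: lab'_def)
    show "sum_list (map fst (lab' K x)) = \<kappa> (cocycle K x)"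
      using lab[OF Kx] 1 by (simp add: lab'_def)
    show "List.map_filter snd (lab' K x) = \<mu> (cocycle K x)"
      using lab[OF Kx] by (simp add: lab'_def 2)
    show "length (lab' K x) = 2 ^ s"
      using s[OF Kx] by (simp add: lab'_def)
  qed
qed

text \<open>
  Reading a letter \<open>x\<close> at the coset \<open>K\<close> emits the label of \<open>cocycle K x\<close> one step at a time.  All
  labels have the same length, so that words of length \<open>k\<close> become paths of length \<open>2\<^sup>s k\<close>.
\<close>

lemma ex_lrational_count:
  fixes M :: "('q, 'a) automaton"
  assumes X: "finite X" "X \<subseteq> carrier G" and M: "finite_automaton X M"
  shows "\<exists>s v F. lrational v F \<and> (\<forall>k. ct F $ (2 ^ s * k) =
    of_nat (card {w \<in> accepted_language X M. length w = k \<and> word_value G w = \<one>}))"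
proof -
  obtain s lab where "\<forall>K\<in>rcosets H. \<forall>x\<in>X. set (lab K x) \<subseteq> box n 1 \<times> insert None (Some ` L)
    \<and> sum_list (map fst (lab K x)) = \<kappa> (cocycle K x)
    \<and> List.map_filter snd (lab K x) = \<mu> (cocycle K x) \<and> length (lab K x) = 2 ^ s"
    using ex_padded_labels[OF X] by blast
  then have lab: "set (lab K x) \<subseteq> box n 1 \<times> insert None (Some ` L)"
    "sum_list (map fst (lab K x)) = \<kappa> (cocycle K x)"
    "List.map_filter snd (lab K x) = \<mu> (cocycle K x)"
    "length (lab K x) = 2 ^ s" if "K \<in> rcosets H" "x \<in> X" for K x
    using that by blast+
  \<comment> \<open>The third component of a state is the part of the current label still to be
    emitted. A letter is read when this part is empty, and that edge already emits the first entry,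
    so each letter takes exactly 2^s edges. The tag keeps the edges of different letters
    apart.\<close>
  define E :: "'q \<times> 'a set \<times> (expo \<times> ('l \<times> bool) option) list \<Rightarrow>
      ('a option \<times> expo \<times> ('l \<times> bool) option \<times> 'q \<times> 'a set \<times> (expo \<times> ('l \<times> bool) option) list) set"
    where "E = (\<lambda>(q, K, es). case es of
      [] \<Rightarrow> (\<lambda>x. (Some x, fst (hd (lab K x)), snd (hd (lab K x)),
                transition M q x, K #> x, tl (lab K x))) ` X
    | e # es \<Rightarrow> {(None, fst e, snd e, q, K, es)})"
  define R where "R = insert [] ((\<lambda>(i, K, x). drop i (lab K x)) ` ({..2 ^ s} \<times> (rcosets H) \<times> X))"
  define S where "S = states M \<times> (rcosets H) \<times> R"
  define Fin where "Fin = final M \<times> {H} \<times> {[] :: (expo \<times> ('l \<times> bool) option) list}"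
  have E_Nil: "E (q, K, []) = (\<lambda>x. (Some x, fst (hd (lab K x)), snd (hd (lab K x)),
      transition M q x, K #> x, tl (lab K x))) ` X" for q K
    by (simp add: E_def)
  have E_Cons: "E (q, K, e # es) = {(None, fst e, snd e, q, K, es)}" for q K e es
    by (simp add: E_def)
  have R_suffix: "es \<in> R" "e \<in> box n 1 \<times> insert None (Some ` L)" if R: "e # es \<in> R" for e es
  proof -
    obtain i K x where i: "i \<le> 2 ^ s" "K \<in> rcosets H" "x \<in> X" "e # es = drop i (lab K x)"
      using R by (auto simp: R_def)
    have "e \<in> set (drop i (lab K x))" using i(4)[symmetric] by simp
    then show "e \<in> box n 1 \<times> insert None (Some ` L)"
      using lab(1)[OF i(2,3)] set_drop_subset[of i "lab K x"] by blast
    have "i < 2 ^ s" using i lab(4)[OF i(2,3)] by (cases "i = 2 ^ s") auto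
    moreover have "es = drop (Suc i) (lab K x)"
      using i(4) by (metis drop_Suc list.sel(3) tl_drop)
    ultimately show "es \<in> R"
      using i(2,3) by (auto simp: R_def intro!: image_eqI[of _ _ "(Suc i, K, x)"])
  qed
  have lab_R: "lab K x \<in> R" "lab K x \<noteq> []" if "K \<in> rcosets H" "x \<in> X" for K x
  proof -
    show "lab K x \<in> R"
      using that by (auto simp: R_def intro!: image_eqI[of _ _ "(0, K, x)"])
    show "lab K x \<noteq> []" using lab(4)[OF that] by auto
  qed
  have edge: "w \<in> box n 1" "b \<in> insert None (Some ` L)" "\<tau> \<in> S"
    if \<sigma>: "\<sigma> \<in> S" and e: "(t, w, b, \<tau>) \<in> E \<sigma>" for \<sigma> t w b \<tau>
  proof -
    obtain q K es where \<sigma>': "\<sigma> = (q, K, es)" "q \<in> states M" "K \<in> rcosets H" "es \<in> R"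
      using \<sigma> by (auto simp: S_def)
    have "w \<in> box n 1 \<and> b \<in> insert None (Some ` L) \<and> \<tau> \<in> S"
    proof (cases es)
      case Nil
      then obtain x where x: "x \<in> X" "w = fst (hd (lab K x))" "b = snd (hd (lab K x))"
        "\<tau> = (transition M q x, K #> x, tl (lab K x))"
        using e by (auto simp: \<sigma>' E_Nil)
      have "hd (lab K x) # tl (lab K x) \<in> R" using lab_R[OF \<sigma>'(3) x(1)] by simp
      from R_suffix[OF this] show ?thesis
        using x \<sigma>' M X(2) rcoset_mult[OF \<sigma>'(3), of x]
        by (auto simp: S_def finite_automaton_def)
    next
      case (Cons e' es')
      with e have "w = fst e'" "b = snd e'" "\<tau> = (q, K, es')" by (auto simp: \<sigma>' E_Cons)
      moreover have "es' \<in> R" "e' \<in> box n 1 \<times> insert None (Some ` L)"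
        using R_suffix \<sigma>'(4) Cons by auto
      ultimately show ?thesis using \<sigma>' by (auto simp: S_def)
    qed
    then show "w \<in> box n 1" "b \<in> insert None (Some ` L)" "\<tau> \<in> S" by auto
  qed
  have "pushdown E S L n"
  proof
    show "finite S"
      using M X(1) finite_index by (auto simp: S_def R_def finite_automaton_def)
    show "finite (E \<sigma>)" if "\<sigma> \<in> S" for \<sigma>
      using X(1) by (auto simp: E_def split: prod.split list.split)
    show "b \<in> L" if "\<sigma> \<in> S" "(t, w, Some b, \<tau>) \<in> E \<sigma>" for \<sigma> t w b \<tau>
      using edge(2)[OF that] by auto
  qed (use finite_L inv_L edge in blast)+
  moreover have "(initial M, H, []) \<in> S"
    using M H_rcoset by (auto simp: S_def R_def finite_automaton_def)
  ultimately obtain v F where F: "lrational v F"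
    "\<And>N. ct F $ N = lookup (walks E Fin N (initial M, H, []) []) 0"
    using pushdown.walks_lrational by metis
  let ?acts = "foldl (\<lambda>u s. act (snd s) u)"
  have walk_label: "walks E Fin (length es + N) (q, K, es) u
      = single (sum_list (map fst es)) 1 * walks E Fin N (q, K, []) (?acts u es)" for es N q K u
  proof (induction es arbitrary: u)
    case (Cons e es)
    then show ?case by (simp add: E_Cons mult_single flip: mult.assoc)
  qed simp
  have walk_letter: "walks E Fin (2 ^ s + N) (q, K, []) u = (\<Sum>x\<in>X. single (\<kappa> (cocycle K x)) 1 *
      walks E Fin N (transition M q x, K #> x, []) (?acts u (lab K x)))"
    if K: "K \<in> rcosets H" for N q K u
  proof -
    obtain P where P: "(2 :: nat) ^ s = Suc P" by (cases "(2 :: nat) ^ s") auto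
    have "walks E Fin (2 ^ s + N) (q, K, []) u
        = (\<Sum>x\<in>X. single (fst (hd (lab K x))) 1 *
            walks E Fin (P + N) (transition M q x, K #> x, tl (lab K x)) (act (snd (hd (lab K x))) u))"
      unfolding P add_Suc walks.simps E_Nil by (subst sum.reindex) (auto simp: inj_on_def)
    also have "\<dots> = (\<Sum>x\<in>X. single (\<kappa> (cocycle K x)) 1 *
      walks E Fin N (transition M q x, K #> x, []) (?acts u (lab K x)))"
    proof (rule sum.cong[OF refl])
      fix x assume x: "x \<in> X"
      obtain e es where es: "lab K x = e # es" using lab_R(2)[OF K x] by (cases "lab K x") auto
      have len: "length es = P" using lab(4)[OF K x] P es by simp
      show "single (fst (hd (lab K x))) 1 *
            walks E Fin (P + N) (transition M q x, K #> x, tl (lab K x)) (act (snd (hd (lab K x))) u)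
          = single (\<kappa> (cocycle K x)) 1 *
            walks E Fin N (transition M q x, K #> x, []) (?acts u (lab K x))"
        using walk_label[of es N "transition M q x" "K #> x" "act (snd e) u"] lab(2)[OF K x]
        by (simp add: es len mult_single flip: mult.assoc)
    qed
    finally show ?thesis .
  qed
  \<comment> \<open>The induction needs an arbitrary start (q, K) and an arbitrary target
    \<open>h\<close> in \<open>H\<close>; the words to be counted are those for the initial state,
    \<open>K = H\<close> and \<open>h = \<one>\<close>.\<close>
  define W where "W q K h k = {w \<in> lists X. length w = k \<and> foldl (transition M) q w \<in> final M \<and>
      rep K \<otimes> word_value G w = h}" for q K h k
  have finite_W: "finite (W q K h k)" for q K h k
    by (rule finite_subset[OF _ finite_lists_length_eq[OF X(1), of k]]) (auto simp: W_def)
  have count: "lookup (walks E Fin (2 ^ s * k) (q, K, []) (\<mu> h)) (\<kappa> h) = of_nat (card (W q K h k))"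
    if "K \<in> rcosets H" "h \<in> H" for q K h k
    using that
  proof (induction k arbitrary: q K h)
    case 0
    have "rep K = h \<longleftrightarrow> K = H \<and> h = \<one>"
      using rep_in_H_iff[OF 0(1)] 0(2) rep_H by auto
    then have "W q K h 0 = (if q \<in> final M \<and> K = H \<and> h = \<one> then {[]} else {})"
      using rep_closed[OF 0(1)] by (auto simp: W_def word_value_def)
    moreover have "lookup (walks E Fin 0 (q, K, []) (\<mu> h)) (\<kappa> h)
        = (if q \<in> final M \<and> K = H \<and> h = \<one> then 1 else 0)"
      using trivial_iff[OF 0(2)] by (auto simp: Fin_def lookup_one when_def)
    ultimately show ?case by simp
  next
    case (Suc k)
    \<comment> \<open>Reading x splits its cocycle off \<open>h\<close> on the left, just as the
      walk does with its label.\<close>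
    let ?h = "\<lambda>x. inv (cocycle K x) \<otimes> h"
    have step: "lookup (single (\<kappa> (cocycle K x)) 1 *
        walks E Fin (2 ^ s * k) (transition M q x, K #> x, []) (?acts (\<mu> h) (lab K x))) (\<kappa> h)
        = of_nat (card (W (transition M q x) (K #> x) (?h x) k))" if x: "x \<in> X" for x
    proof -
      have xG: "x \<in> carrier G" using x X by auto
      note c = cocycle_in[OF Suc.prems(1) xG]
      have h': "?h x \<in> H" using c Suc.prems(2) by simp
      have h: "h = cocycle K x \<otimes> ?h x"
        using c Suc.prems(2) by (simp flip: m_assoc)
      have "\<mu> h = foldr reduced_Cons (\<mu> (cocycle K x)) (\<mu> (?h x))"
        by (subst h) (rule \<mu>_mult[OF c h'])
      then have "?acts (\<mu> h) (lab K x) = \<mu> (?h x)"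
        using acts_cancel[OF \<mu>_reduced[OF h'], of "lab K x"] lab(3)[OF Suc.prems(1) x] by simp
      moreover have "\<kappa> h = \<kappa> (cocycle K x) + \<kappa> (?h x)"
        by (subst h) (rule \<kappa>_mult[OF c h'])
      ultimately show ?thesis
        using Suc.IH[OF rcoset_mult[OF Suc.prems(1) xG] h']
        by (simp add: lookup_single_times)
    qed
    have W: "W q K h (Suc k)
        = (\<Union>x\<in>X. (#) x ` W (transition M q x) (K #> x) (?h x) k)"
    proof -
      have iff: "rep K \<otimes> word_value G (x # w) = h \<longleftrightarrow> rep (K #> x) \<otimes> word_value G w = ?h x"
        if x: "x \<in> X" and w: "w \<in> lists X" for x w
      proof -
        have xG: "x \<in> carrier G" and wG: "word_value G w \<in> carrier G"
          using x X w word_value_closed[of w] by (auto simp: in_lists_conv_set)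
        note c = cocycle_in[OF Suc.prems(1) xG]
        note r = rep_closed[OF Suc.prems(1)] rep_closed[OF rcoset_mult[OF Suc.prems(1) xG]]
        have "rep K \<otimes> word_value G (x # w) = rep K \<otimes> x \<otimes> word_value G w"
          using xG wG r by (simp add: word_value_def m_assoc)
        also have "\<dots> = cocycle K x \<otimes> (rep (K #> x) \<otimes> word_value G w)"
          using cocycle_eq[OF Suc.prems(1) xG] c r wG by (simp add: m_assoc)
        finally show ?thesis
          using c r wG Suc.prems(2) inv_solve_left[of "rep (K #> x) \<otimes> word_value G w" "cocycle K x" h]
          by auto
      qed
      show ?thesis
      proof (intro equalityI subsetI)
        fix w assume w: "w \<in> W q K h (Suc k)"
        then obtain x w' where "w = x # w'" by (cases w) (auto simp: W_def)
        with w iff[of x w'] show "w \<in> (\<Union>x\<in>X. (#) x ` W (transition M q x) (K #> x) (?h x) k)"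
          by (auto simp: W_def)
      next
        fix w assume "w \<in> (\<Union>x\<in>X. (#) x ` W (transition M q x) (K #> x) (?h x) k)"
        then obtain x w' where "x \<in> X" "w = x # w'" "w' \<in> W (transition M q x) (K #> x) (?h x) k"
          by auto
        with iff[of x w'] show "w \<in> W q K h (Suc k)" by (auto simp: W_def)
      qed
    qed
    have "card (W q K h (Suc k)) = (\<Sum>x\<in>X. card ((#) x ` W (transition M q x) (K #> x) (?h x) k))"
      unfolding W using X(1) finite_W by (intro card_UN_disjoint) auto
    also have "\<dots> = (\<Sum>x\<in>X. card (W (transition M q x) (K #> x) (?h x) k))"
      by (intro sum.cong refl card_image) (auto simp: inj_on_def)
    finally have card: "card (W q K h (Suc k)) = \<dots>" .
    have "2 ^ s * Suc k = 2 ^ s + 2 ^ s * k" by simp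
    then show ?case
      by (simp only: walk_letter[OF Suc.prems(1)] lookup_sum card of_nat_sum) (simp add: step)
  qed
  have "ct F $ (2 ^ s * k) =
      of_nat (card {w \<in> accepted_language X M. length w = k \<and> word_value G w = \<one>})" for k
  proof -
    have one: "\<kappa> \<one> = 0" "\<mu> \<one> = []" using trivial_iff[of \<one>] by auto
    have "W (initial M) H \<one> k = {w \<in> accepted_language X M. length w = k \<and> word_value G w = \<one>}"
      using word_value_closed X(2) lists_mono[OF X(2)]
      by (auto simp: W_def accepted_language_def rep_H in_lists_conv_set subset_iff)
    then show ?thesis
      using count[OF H_rcoset one_closed, of k "initial M"] F(2)[of "2 ^ s * k"] by (simp add: one)
  qed
  with F(1) show ?thesis by blast
qed

end

section \<open>Transfer along the isomorphism of \<open>H\<close> with the product\<close>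

theorem theoremA:
  fixes G :: "('a, 'b) monoid_scheme" and n m :: nat
  assumes "group G"
    and "subgroup H G"
    and "finite (rcosets\<^bsub>G\<^esub> H)"
    and "G\<lparr>carrier := H\<rparr> \<cong>
           product_group {..<n} (\<lambda>_. integer_group) \<times>\<times> free_group {..<m}"
    and "finite_monoid_generating_set G X"
    and "regular_language X R"
  shows "\<exists>p\<ge>1. \<exists>r. rational_mfps p r \<and> cogrowth_series G R = diagonal p r"
proof -
  interpret group G by fact
  interpret subgroup H G by fact
  let ?Z = "product_group {..<n} (\<lambda>_. integer_group)" and ?F = "free_group {..<m}"
  have groups: "group ?Z" "group ?F" by (auto simp: group_free_group)
  obtain \<psi> where \<psi>: "\<psi> \<in> iso (G\<lparr>carrier := H\<rparr>) (?Z \<times>\<times> ?F)"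
    using assms(4) by (auto simp: is_iso_def)
  define \<kappa> where "\<kappa> h = (\<Sum>i<n. single i (fst (\<psi> h) i))" for h
  define \<mu> where "\<mu> h = snd (\<psi> h)" for h
  have \<kappa>: "lookup (\<kappa> h) i = (if i < n then fst (\<psi> h) i else 0)" for h i
    by (simp add: \<kappa>_def lookup_sum lookup_single when_def)
  have mult: "\<psi> (g \<otimes>\<^bsub>G\<^esub> h) = \<psi> g \<otimes>\<^bsub>?Z \<times>\<times> ?F\<^esub> \<psi> h" if "g \<in> H" "h \<in> H" for g h
    using \<psi> that by (auto simp: iso_def hom_def)
  have closed: "\<psi> h \<in> carrier ?Z \<times> carrier ?F" if "h \<in> H" for h
    using \<psi> that by (auto simp: iso_def hom_def)
  have one: "\<psi> \<one>\<^bsub>G\<^esub> = (\<one>\<^bsub>?Z\<^esub>, \<one>\<^bsub>?F\<^esub>)"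
    using hom_one[of \<psi> "G\<lparr>carrier := H\<rparr>" "?Z \<times>\<times> ?F"] \<psi> groups subgroup_imp_group[OF assms(2)]
    by (auto simp: iso_def DirProd_group)
  have inj: "inj_on \<psi> H" using \<psi> by (auto simp: iso_def bij_betw_def)
  interpret virtually_product G H \<kappa> \<mu> n "{..<m} \<times> UNIV"
  proof
    fix g h assume gh: "g \<in> H" "h \<in> H"
    show "\<kappa> (g \<otimes>\<^bsub>G\<^esub> h) = \<kappa> g + \<kappa> h"
      by (rule poly_mapping_eqI) (simp add: \<kappa> lookup_add mult[OF gh] DirProd_def split_beta)
    show "\<mu> (g \<otimes>\<^bsub>G\<^esub> h) = foldr reduced_Cons (\<mu> g) (\<mu> h)"
      by (simp add: \<mu>_def mult[OF gh] DirProd_def split_beta free_group_def)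
  next
    fix h assume h: "h \<in> H"
    show "keys (\<kappa> h) \<subseteq> {..<n}" by (auto simp: in_keys_iff \<kappa> split: if_splits)
    show "set (\<mu> h) \<subseteq> {..<m} \<times> UNIV" "freely_reduced (\<mu> h)"
      using closed[OF h] by (auto simp: \<mu>_def free_group_def mem_Times_iff)
    show "\<kappa> h = 0 \<and> \<mu> h = [] \<longleftrightarrow> h = \<one>\<^bsub>G\<^esub>"
    proof
      assume *: "\<kappa> h = 0 \<and> \<mu> h = []"
      have "fst (\<psi> h) i = \<one>\<^bsub>?Z\<^esub> i" for i
      proof (cases "i < n")
        case True
        have "lookup (\<kappa> h) i = 0" using * by simp
        with True show ?thesis by (simp add: \<kappa>)
      next
        case False
        \<comment> \<open>Elements of the product group are extensional: outside the index set both
          functions take the value \<open>undefined\<close>, so they agree there too.\<close>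
        have "fst (\<psi> h) \<in> (\<Pi>\<^sub>E i\<in>{..<n}. carrier integer_group)"
          using closed[OF h] by (simp add: mem_Times_iff)
        then have "fst (\<psi> h) i = undefined" by (rule PiE_arb) (use False in simp)
        with False show ?thesis by simp
      qed
      then have "\<psi> h = \<psi> \<one>\<^bsub>G\<^esub>"
        using * by (simp add: one prod_eq_iff fun_eq_iff \<mu>_def free_group_def)
      then show "h = \<one>\<^bsub>G\<^esub>" using inj h by (auto dest: inj_onD)
    next
      assume "h = \<one>\<^bsub>G\<^esub>"
      then show "\<kappa> h = 0 \<and> \<mu> h = []"
        by (auto simp: \<mu>_def one free_group_def \<kappa> intro!: poly_mapping_eqI)
    qed
  next
    fix b :: "nat \<times> bool" assume "b \<in> {..<m} \<times> UNIV"
    then show "inv_letter b \<in> {..<m} \<times> UNIV" by (cases b) auto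
  qed (use assms(3) in auto)
  obtain M :: "(nat, 'a) automaton" where M: "finite_automaton X M" "R = accepted_language X M"
    using assms(6) by (auto simp: regular_language_def)
  have X: "finite X" "X \<subseteq> carrier G"
    using assms(5) by (auto simp: finite_monoid_generating_set_def)
  obtain s v F where F: "lrational v F" "\<And>k. ct F $ (2 ^ s * k) =
      of_nat (card {w \<in> R. length w = k \<and> word_value G w = \<one>\<^bsub>G\<^esub>})"
    using ex_lrational_count[OF X M(1)] M(2) by auto
  \<comment> \<open>Words of length k were counted in degree 2^s k; iterating \<open>half\<close> s
    times moves them to degree k.\<close>
  have "cogrowth_series G R = ct ((half ^^ s) F)"
    by (rule fps_ext) (simp add: cogrowth_series_def ct_funpow_half F(2) del: ct_nth)
  moreover obtain r where "rational_mfps (Suc v) r" "ct ((half ^^ s) F) = diagonal (Suc v) r"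
    using ct_lrational_diagonal[OF lrational_funpow_half[OF F(1)]] by blast
  ultimately show ?thesis by (intro exI[of _ "Suc v"] conjI exI[of _ r]) simp_all
qed

end
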